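(* Let $E:\mathbb{R}^n\to\mathbb{R}$ satisfy Assumption A, let $G=\nabla\nabla E$, let $0\le k\le n$, $\beta,\gamma>0$, $\sigma\in\{+1,-1\}$, and let $\epsilon$ be an admissible rate function (Assumption A and admissibility are defined in the context). Consider the system (iHiSD) $$\dot x=\beta\big(-\alpha R+\sigma(1-\alpha)I\big)\nabla E(x),\qquad \dot R=\gamma\big(G(x)-RG(x)R\big),\qquad \dot\alpha=\epsilon(\alpha)$$ for $(x,R,\alpha)\in\mathbb{R}^n\times\mathcal{R}_k\times[0,1]$. A triplet $(x^*,R^*,\alpha^* )\in\mathbb{R}^n\times\mathcal{R}_k\times[0,1]$ is an equilibrium point of this system if and only if $\nabla E(x^* )=0$, $G(x^* )R^*=R^*G(x^* )$ and $\alpha^*\in\{0,1\}$. Moreover, for such an equilibrium point, if $G(x^* )$ is non-degenerate and has distinct eigenvalues, then $(x^*,R^*,\alpha^* )$ is locally stable if and only if $x^*$ is a $k$-saddle, $R^*$ is the reflection about the sum of the eigenspaces of $G(x^* )$ corresponding to positive eigenvalues, and $\alpha^*=1$.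
   Context: A stationary point of $E$ is a point where $\nabla E=0$; it is non-degenerate if the Hessian $G=\nabla\nabla E$ is non-degenerate there; its (Morse) index is the number of negative eigenvalues of $G$ there; a $k$-saddle is a stationary point of index $k$ ($k\ge0$), and "saddle point" means a $k$-saddle for some $k$. A Morse function is a smooth function all of whose stationary points are non-degenerate. A Morse-Smale function is a Morse function such that, for the gradient flow $\dot x=-\nabla E(x)$, the stable manifold and the unstable manifold of any two stationary points intersect transversally. Assumption A: $E$ is a Morse-Smale function on $\mathbb{R}^n$ whose sublevel sets $\{x:E(x)\le c\}$ are compact for all $c$, and the Hessian of $E$ has distinct eigenvalues at each saddle point. $\mathcal{R}_k=\{R\in\mathrm{Sym}_n:R^2=I,\ \dim\ker(R+I)=k\}$, where $\mathrm{Sym}_n$ is the space of real symmetric $n\times n$ matrices; the vector field above is tangent to $\mathcal{R}_k$ in the $R$ component. Admissible rate function: $\epsilon$ is smooth and there exist $C_1,C_2>0$ with $C_1\alpha(1-\alpha)\le\epsilon(\alpha)\le C_2\alpha(1-\alpha)$ for $\alpha\in[0,1]$. "Locally stable" refers to linear stability: every eigenvalue of the Jacobian of the vector field at the equilibrium, acting on the tangent space $\mathbb{R}^n\times T_{R^*}\mathcal{R}_k\times\mathbb{R}$, has negative real part. The reflection about a subspace $V$ is the orthogonal matrix equal to $+I$ on $V$ and $-I$ on $V^\perp$. *)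

theory Defs
  imports "HOL-Analysis.Analysis"
begin

section \<open>Smoothness and differential operators\<close>

text \<open>
  \<open>Ck_on k S f\<close>: the iterated directional derivatives of \<open>f\<close> up to order \<open>k\<close> exist and are
  continuous on \<open>S\<close>. It is meant for \<open>S = UNIV\<close> and for nondegenerate intervals, where the
  derivative within \<open>S\<close> is unique (at an end point of an interval it is the one-sided one).
\<close>

primrec Ck_on :: "nat \<Rightarrow> 'a::euclidean_space set \<Rightarrow> ('a \<Rightarrow> 'b::real_normed_vector) \<Rightarrow> bool" where
  "Ck_on 0 S f \<longleftrightarrow> continuous_on S f"
| "Ck_on (Suc k) S f \<longleftrightarrow>
     (\<forall>x\<in>S. f differentiable (at x within S)) \<and>
     (\<forall>v. Ck_on k S (\<lambda>x. frechet_derivative f (at x within S) v))"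

definition smooth_on :: "'a::euclidean_space set \<Rightarrow> ('a \<Rightarrow> 'b::real_normed_vector) \<Rightarrow> bool" where
  "smooth_on S f \<longleftrightarrow> (\<forall>k. Ck_on k S f)"

definition grad :: "(real^'n \<Rightarrow> real) \<Rightarrow> real^'n \<Rightarrow> real^'n" where
  "grad E x = (\<chi> i. frechet_derivative E (at x) (axis i 1))"

definition hessian :: "(real^'n \<Rightarrow> real) \<Rightarrow> real^'n \<Rightarrow> real^'n^'n" where
  "hessian E x = jacobian (grad E) (at x)"


section \<open>Spectral notions\<close>

definition eigenspace :: "real^'n^'n \<Rightarrow> real \<Rightarrow> (real^'n) set" where
  "eigenspace A l = {v. A *v v = l *\<^sub>R v}"

definition eigenvalues :: "real^'n^'n \<Rightarrow> real set" where
  "eigenvalues A = {l. \<exists>v. v \<noteq> 0 \<and> A *v v = l *\<^sub>R v}"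

definition distinct_eigenvalues :: "real^'n^'n \<Rightarrow> bool" where
  "distinct_eigenvalues A \<longleftrightarrow> card (eigenvalues A) = CARD('n)"

text \<open>Number of negative eigenvalues counted with multiplicity; for a symmetric matrix the
  multiplicity of an eigenvalue is the dimension of its eigenspace.\<close>

definition neg_index :: "real^'n^'n \<Rightarrow> nat" where
  "neg_index A = (\<Sum>l\<in>{l \<in> eigenvalues A. l < 0}. dim (eigenspace A l))"

text \<open>
  \<open>z\<close> is an eigenvalue of the complexification of the real linear map \<open>J\<close> restricted to the
  subspace \<open>T\<close>, with eigenvector \<open>u + i v\<close>: the two equations are the real and imaginary parts
  of \<open>J (u + i v) = z (u + i v)\<close>.
\<close>

definition complex_eigenvalue_on ::
    "'a::real_vector set \<Rightarrow> ('a \<Rightarrow> 'a) \<Rightarrow> complex \<Rightarrow> bool" where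
  "complex_eigenvalue_on T J z \<longleftrightarrow>
     (\<exists>u\<in>T. \<exists>v\<in>T. (u \<noteq> 0 \<or> v \<noteq> 0) \<and>
        J u = Re z *\<^sub>R u - Im z *\<^sub>R v \<and>
        J v = Im z *\<^sub>R u + Re z *\<^sub>R v)"


section \<open>Stationary points and Morse-Smale functions\<close>

definition stationary :: "(real^'n \<Rightarrow> real) \<Rightarrow> real^'n \<Rightarrow> bool" where
  "stationary E x \<longleftrightarrow> grad E x = 0"

definition k_saddle :: "nat \<Rightarrow> (real^'n \<Rightarrow> real) \<Rightarrow> real^'n \<Rightarrow> bool" where
  "k_saddle k E x \<longleftrightarrow> stationary E x \<and> neg_index (hessian E x) = k"

definition saddle :: "(real^'n \<Rightarrow> real) \<Rightarrow> real^'n \<Rightarrow> bool" where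
  "saddle E x \<longleftrightarrow> (\<exists>k. k_saddle k E x)"

definition morse :: "(real^'n \<Rightarrow> real) \<Rightarrow> bool" where
  "morse E \<longleftrightarrow> smooth_on UNIV E \<and> (\<forall>x. stationary E x \<longrightarrow> invertible (hessian E x))"

text \<open>Tangent space of a submanifold \<open>M\<close> of a normed space at \<open>q\<close>: the velocities at \<open>q\<close> of
  the \<open>C\<^sup>1\<close> curves in \<open>M\<close> through \<open>q\<close>.\<close>

definition tangent_space :: "'a::real_normed_vector set \<Rightarrow> 'a \<Rightarrow> 'a set" where
  "tangent_space M q = {v. \<exists>d>0. \<exists>c::real \<Rightarrow> 'a.
      c C1_differentiable_on {-d<..<d} \<and> c ` {-d<..<d} \<subseteq> M \<and> c 0 = q \<and>
      (c has_vector_derivative v) (at 0)}"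

text \<open>
  The stable and unstable manifolds are described by single trajectories, so that no global flow
  is needed: trajectories of the gradient flow may fail to exist for all negative times.
\<close>

definition stable_manifold :: "(real^'n \<Rightarrow> real) \<Rightarrow> real^'n \<Rightarrow> (real^'n) set" where
  "stable_manifold E p = {q. \<exists>x::real \<Rightarrow> real^'n. x 0 = q \<and>
      (\<forall>t\<in>{0..}. (x has_vector_derivative - grad E (x t)) (at t within {0..})) \<and>
      (x \<longlongrightarrow> p) at_top}"

definition unstable_manifold :: "(real^'n \<Rightarrow> real) \<Rightarrow> real^'n \<Rightarrow> (real^'n) set" where
  "unstable_manifold E p = {q. \<exists>x::real \<Rightarrow> real^'n. x 0 = q \<and>
      (\<forall>t\<in>{..0}. (x has_vector_derivative - grad E (x t)) (at t within {..0})) \<and>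
      (x \<longlongrightarrow> p) at_bot}"

definition transversal :: "(real^'n) set \<Rightarrow> (real^'n) set \<Rightarrow> bool" where
  "transversal M N \<longleftrightarrow>
     (\<forall>q\<in>M \<inter> N. {u + v | u v. u \<in> tangent_space M q \<and> v \<in> tangent_space N q} = UNIV)"

definition morse_smale :: "(real^'n \<Rightarrow> real) \<Rightarrow> bool" where
  "morse_smale E \<longleftrightarrow> morse E \<and>
     (\<forall>p q. stationary E p \<longrightarrow> stationary E q \<longrightarrow>
        transversal (stable_manifold E p) (unstable_manifold E q))"

definition assumption_A :: "(real^'n \<Rightarrow> real) \<Rightarrow> bool" where
  "assumption_A E \<longleftrightarrow> morse_smale E \<and> (\<forall>c. compact {x. E x \<le> c}) \<and>
     (\<forall>x. saddle E x \<longrightarrow> distinct_eigenvalues (hessian E x))"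


section \<open>The iHiSD system\<close>

definition reflections :: "nat \<Rightarrow> (real^'n^'n) set" where
  "reflections k = {R. transpose R = R \<and> R ** R = mat 1 \<and> dim {v. (R + mat 1) *v v = 0} = k}"

definition is_reflection_about :: "real^'n^'n \<Rightarrow> (real^'n) set \<Rightarrow> bool" where
  "is_reflection_about R V \<longleftrightarrow>
     orthogonal_matrix R \<and> (\<forall>v\<in>V. R *v v = v) \<and> (\<forall>v\<in>V\<^sup>\<bottom>. R *v v = - v)"

definition positive_eigensum :: "real^'n^'n \<Rightarrow> (real^'n) set" where
  "positive_eigensum A = span (\<Union>l\<in>{l \<in> eigenvalues A. l > 0}. eigenspace A l)"

definition admissible_rate :: "(real \<Rightarrow> real) \<Rightarrow> bool" where
  "admissible_rate \<epsilon> \<longleftrightarrow> smooth_on {0..1} \<epsilon> \<and>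
     (\<exists>C1>0. \<exists>C2>0. \<forall>\<alpha>\<in>{0..1}.
        C1 * (\<alpha> * (1 - \<alpha>)) \<le> \<epsilon> \<alpha> \<and> \<epsilon> \<alpha> \<le> C2 * (\<alpha> * (1 - \<alpha>)))"

type_synonym 'n ihisd_state = "(real^'n) \<times> (real^'n^'n) \<times> real"

definition ihisd_states :: "nat \<Rightarrow> ('n::finite) ihisd_state set" where
  "ihisd_states k = UNIV \<times> reflections k \<times> {0..1}"

definition ihisd_field ::
    "(real^'n \<Rightarrow> real) \<Rightarrow> real \<Rightarrow> real \<Rightarrow> real \<Rightarrow> (real \<Rightarrow> real) \<Rightarrow> 'n ihisd_state \<Rightarrow> 'n ihisd_state" where
  "ihisd_field E \<beta> \<gamma> \<sigma> \<epsilon> = (\<lambda>(x, R, \<alpha>).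
     (\<beta> *\<^sub>R (((- \<alpha>) *\<^sub>R R + (\<sigma> * (1 - \<alpha>)) *\<^sub>R mat 1) *v grad E x),
      \<gamma> *\<^sub>R (hessian E x - R ** hessian E x ** R),
      \<epsilon> \<alpha>))"

definition ihisd_equilibrium ::
    "nat \<Rightarrow> (real^'n \<Rightarrow> real) \<Rightarrow> real \<Rightarrow> real \<Rightarrow> real \<Rightarrow> (real \<Rightarrow> real) \<Rightarrow> 'n ihisd_state \<Rightarrow> bool" where
  "ihisd_equilibrium k E \<beta> \<gamma> \<sigma> \<epsilon> p \<longleftrightarrow>
     p \<in> ihisd_states k \<and> ihisd_field E \<beta> \<gamma> \<sigma> \<epsilon> p = 0"

text \<open>The \<open>\<alpha>\<close> component is the full line also at the end points of \<open>{0..1}\<close>.\<close>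

definition ihisd_tangent :: "nat \<Rightarrow> ('n::finite) ihisd_state \<Rightarrow> 'n ihisd_state set" where
  "ihisd_tangent k = (\<lambda>(x, R, \<alpha>). UNIV \<times> tangent_space (reflections k) R \<times> UNIV)"

text \<open>
  The formula for the field makes sense for all matrices \<open>R\<close>, so its Jacobian is taken in the
  ambient space and then restricted to the tangent space. The derivative is one-sided in \<open>\<alpha>\<close>
  at \<open>0\<close> and \<open>1\<close>, because \<open>\<epsilon>\<close> is only given on \<open>{0..1}\<close>.
\<close>

definition ihisd_jacobian ::
    "(real^'n \<Rightarrow> real) \<Rightarrow> real \<Rightarrow> real \<Rightarrow> real \<Rightarrow> (real \<Rightarrow> real) \<Rightarrow> 'n ihisd_state
      \<Rightarrow> 'n ihisd_state \<Rightarrow> 'n ihisd_state" where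
  "ihisd_jacobian E \<beta> \<gamma> \<sigma> \<epsilon> p =
     frechet_derivative (ihisd_field E \<beta> \<gamma> \<sigma> \<epsilon>) (at p within UNIV \<times> UNIV \<times> {0..1})"

definition ihisd_locally_stable ::
    "nat \<Rightarrow> (real^'n \<Rightarrow> real) \<Rightarrow> real \<Rightarrow> real \<Rightarrow> real \<Rightarrow> (real \<Rightarrow> real) \<Rightarrow> 'n ihisd_state \<Rightarrow> bool" where
  "ihisd_locally_stable k E \<beta> \<gamma> \<sigma> \<epsilon> p \<longleftrightarrow>
     (\<forall>z. complex_eigenvalue_on (ihisd_tangent k p) (ihisd_jacobian E \<beta> \<gamma> \<sigma> \<epsilon> p) z \<longrightarrow> Re z < 0)"

end

theory Submission
  imports Defs
begin

text \<open>
  An equilibrium has \<open>\<alpha> \<in> {0, 1}\<close>, because the rate vanishes only there; then the matrix in front of the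
  gradient is invertible, and \<open>H = R H R\<close> means that the involution \<open>R\<close> commutes with the Hessian \<open>H\<close>.

  For the stability, let the eigenvalues of \<open>H\<close> be distinct and nonzero. Since \<open>R\<close> commutes with \<open>H\<close>, an
  orthonormal eigenbasis \<open>e l\<close> of \<open>H\<close>, indexed by the eigenvalues \<open>l\<close>, also diagonalizes \<open>R\<close>, with signs
  \<open>r l\<close>. The gradient vanishes at \<open>x\<close>, so the Jacobian is block triangular: the \<open>x\<close> block and the \<open>\<alpha>\<close>
  block are autonomous, and the \<open>R\<close> block is driven by \<open>x\<close>. The \<open>\<alpha>\<close> block is the slope of the rate, which
  is positive at \<open>0\<close> and negative at \<open>1\<close> (\<open>admissible_rate_derivative\<close>), so stability needs \<open>\<alpha> = 1\<close>.
  The \<open>x\<close> block is then \<open>- \<beta> R H\<close> with eigenvalues \<open>- \<beta> r l * l\<close>, so stability forces \<open>r l\<close> to be the sign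
  of \<open>l\<close> (\<open>stable_imp_sign_product_nonneg\<close>). This says exactly that \<open>R\<close> is the reflection about the
  positive eigenspaces (\<open>reflection_about_positive_eigensum_iff\<close>), and it makes the number of negative
  eigenvalues equal to the dimension \<open>k\<close> of the kernel of \<open>R + I\<close> (\<open>neg_index_eq_reflection_index\<close>).

  Conversely, for these signs \<open>K = R H\<close> is positive definite, and the \<open>R\<close> block \<open>S \<mapsto> - \<gamma> (S K + K S)\<close> is
  negative definite for the Frobenius inner product (\<open>lyapunov_operator_positive\<close>); so all three
  diagonal blocks are negative definite (\<open>positive_definite_imp_stable\<close>).

  Two inputs need work of their own. The Hessian is symmetric (\<open>mixed_derivatives_commute\<close>). And passing
  an unstable eigenvalue of the \<open>x\<close> block to the whole Jacobian
  (\<open>left_eigenvector_imp_eigenvector\<close>) takes a tangent space that is a linear subspace invariant under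
  the Jacobian; it is computed in \<open>tangent_space_reflections\<close> by moving \<open>R\<close> with curves of rotations.
\<close>

section \<open>Matrix algebra\<close>

text \<open>
  The product \<open>**\<close> is not the multiplication of a type class, so distributivity, continuity and the
  product rule for matrix products all come from bilinearity.
\<close>

lemma bounded_bilinear_matrix_mult:
  "bounded_bilinear ((**) :: real^'n^'m \<Rightarrow> real^'p^'n \<Rightarrow> real^'p^'m)"
proof -
  have "bilinear ((**) :: real^'n^'m \<Rightarrow> real^'p^'n \<Rightarrow> real^'p^'m)"
    unfolding bilinear_def
    by (auto intro!: linearI simp: vec_eq_iff matrix_matrix_mult_def algebra_simps
        sum.distrib sum_distrib_left)
  then show ?thesis
    by (simp add: bilinear_conv_bounded_bilinear)
qed

lemma bounded_bilinear_matrix_vector: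
  "bounded_bilinear ((*v) :: real^'n^'m \<Rightarrow> real^'n \<Rightarrow> real^'m)"
proof -
  have "bilinear ((*v) :: real^'n^'m \<Rightarrow> real^'n \<Rightarrow> real^'m)"
    unfolding bilinear_def
    by (auto intro!: linearI simp: vec_eq_iff matrix_vector_mult_def algebra_simps
        sum.distrib sum_distrib_left)
  then show ?thesis
    by (simp add: bilinear_conv_bounded_bilinear)
qed

interpretation mm: bounded_bilinear "(**) :: real^'n^'m \<Rightarrow> real^'p^'n \<Rightarrow> real^'p^'m"
  by (rule bounded_bilinear_matrix_mult)

interpretation mv: bounded_bilinear "(*v) :: real^'n^'m \<Rightarrow> real^'n \<Rightarrow> real^'m"
  by (rule bounded_bilinear_matrix_vector)

lemmas matrix_expand =
  mm.add_left mm.add_right mm.diff_left mm.diff_right mm.minus_left mm.minus_right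
  mm.scaleR_left mm.scaleR_right matrix_mul_assoc

lemma linear_transpose: "linear (transpose :: real^'n^'m \<Rightarrow> real^'m^'n)"
  by (rule linearI) (simp_all add: transpose_def vec_eq_iff)

lemmas transpose_expand =
  linear_add[OF linear_transpose] linear_diff[OF linear_transpose] linear_neg[OF linear_transpose]
  linear_cmul[OF linear_transpose] linear_0[OF linear_transpose] matrix_transpose_mul

lemma symmetric_matrix_inner:
  fixes A :: "real^'n^'n"
  assumes "transpose A = A"
  shows "(A *v u) \<bullet> v = u \<bullet> (A *v v)"
  by (metis assms dot_lmul_matrix transpose_matrix_vector)

lemma inner_transpose_matrix:
  fixes A B :: "real^'n^'m"
  shows "transpose A \<bullet> transpose B = A \<bullet> B"
  unfolding inner_vec_def transpose_def by (simp, subst sum.swap) simp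

section \<open>Symmetry and smoothness of the Hessian\<close>

text \<open>
  Two applications of the mean value theorem, in the directions \<open>v\<close> and then \<open>w\<close>, to an expression
  that is symmetric in \<open>v\<close> and \<open>w\<close>.
\<close>

lemma second_difference_eq_mixed_derivative:
  fixes f :: "'a::real_normed_vector \<Rightarrow> real"
  assumes f: "\<And>x. (f has_derivative f' x) (at x)"
    and fv: "\<And>x. ((\<lambda>y. f' y v) has_derivative fv x) (at x)"
    and h: "h > 0"
  obtains s t where "0 < s" "s < h" "0 < t" "t < h"
    "f (x + h *\<^sub>R v + h *\<^sub>R w) - f (x + h *\<^sub>R v) - f (x + h *\<^sub>R w) + f x
      = h * h * fv (x + s *\<^sub>R v + t *\<^sub>R w) w"
proof -
  define g where "g s = f (x + s *\<^sub>R v + h *\<^sub>R w) - f (x + s *\<^sub>R v)" for s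
  have gd: "(g has_real_derivative
      f' (x + s *\<^sub>R v + h *\<^sub>R w) v - f' (x + s *\<^sub>R v) v) (at s)" for s
  proof -
    have 1: "((\<lambda>s. f (x + s *\<^sub>R v + y)) has_derivative (\<lambda>d. f' (x + s *\<^sub>R v + y) (d *\<^sub>R v))) (at s)" for y
      by (rule has_derivative_compose[OF _ f]) (auto intro!: derivative_eq_intros)
    have lin: "linear (f' y)" for y
      using f has_derivative_linear by blast
    show ?thesis
      unfolding g_def has_field_derivative_def
      by (rule has_derivative_eq_rhs[OF has_derivative_diff[OF 1 1[of 0, simplified]]])
        (auto simp: linear_cmul[OF lin] algebra_simps)
  qed
  obtain s where s: "0 < s" "s < h" and gs: "g h - g 0 =
      (h - 0) * (f' (x + s *\<^sub>R v + h *\<^sub>R w) v - f' (x + s *\<^sub>R v) v)"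
    using MVT2[OF h, of g "\<lambda>s. f' (x + s *\<^sub>R v + h *\<^sub>R w) v - f' (x + s *\<^sub>R v) v"] gd by metis
  define k where "k t = f' (x + s *\<^sub>R v + t *\<^sub>R w) v" for t
  have kd: "(k has_real_derivative fv (x + s *\<^sub>R v + t *\<^sub>R w) w) (at t)" for t
  proof -
    have 1: "(k has_derivative (\<lambda>d. fv (x + s *\<^sub>R v + t *\<^sub>R w) (d *\<^sub>R w))) (at t)"
      unfolding k_def
      by (rule has_derivative_compose[OF _ fv]) (auto intro!: derivative_eq_intros)
    have lin: "linear (fv y)" for y
      using fv has_derivative_linear by blast
    show ?thesis
      unfolding has_field_derivative_def
      by (rule has_derivative_eq_rhs[OF 1]) (auto simp: linear_cmul[OF lin] algebra_simps)
  qed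
  obtain t where t: "0 < t" "t < h" and kt: "k h - k 0 = (h - 0) * fv (x + s *\<^sub>R v + t *\<^sub>R w) w"
    using MVT2[OF h, of k "\<lambda>t. fv (x + s *\<^sub>R v + t *\<^sub>R w) w"] kd by metis
  show ?thesis
    using that[OF s t] gs kt by (simp add: g_def k_def algebra_simps)
qed

text \<open>
  The second difference does not see the order of the directions. Dividing it by \<open>h\<^sup>2\<close> gives a value
  of either mixed derivative at a point that tends to \<open>x\<close> with \<open>h\<close>, so continuity at \<open>x\<close> suffices.
\<close>

lemma mixed_derivatives_commute:
  fixes f :: "'a::real_normed_vector \<Rightarrow> real"
  assumes f: "\<And>x. (f has_derivative f' x) (at x)"
    and fv: "\<And>x. ((\<lambda>y. f' y v) has_derivative fv x) (at x)"
    and fw: "\<And>x. ((\<lambda>y. f' y w) has_derivative fw x) (at x)"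
    and cv: "isCont (\<lambda>x. fv x w) x" and cw: "isCont (\<lambda>x. fw x v) x"
  shows "fv x w = fw x v"
proof -
  have close: "\<exists>p q. norm (p - x) \<le> h * (norm v + norm w) \<and> norm (q - x) \<le> h * (norm v + norm w)
      \<and> fv p w = fw q v" if h: "h > 0" for h
  proof -
    obtain s t where st: "0 < s" "s < h" "0 < t" "t < h"
      "f (x + h *\<^sub>R v + h *\<^sub>R w) - f (x + h *\<^sub>R v) - f (x + h *\<^sub>R w) + f x
        = h * h * fv (x + s *\<^sub>R v + t *\<^sub>R w) w"
      using second_difference_eq_mixed_derivative[OF f fv h] by blast
    obtain s' t' where st': "0 < s'" "s' < h" "0 < t'" "t' < h"
      "f (x + h *\<^sub>R w + h *\<^sub>R v) - f (x + h *\<^sub>R w) - f (x + h *\<^sub>R v) + f x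
        = h * h * fw (x + s' *\<^sub>R w + t' *\<^sub>R v) v"
      using second_difference_eq_mixed_derivative[OF f fw h] by blast
    have bound: "norm (a *\<^sub>R y + b *\<^sub>R z) \<le> h * (norm y + norm z)"
      if "0 < a" "a < h" "0 < b" "b < h" for a b and y z :: 'a
    proof -
      have "norm (a *\<^sub>R y + b *\<^sub>R z) \<le> a * norm y + b * norm z"
        using that norm_triangle_ineq[of "a *\<^sub>R y" "b *\<^sub>R z"] by simp
      also have "\<dots> \<le> h * norm y + h * norm z"
        using that by (intro add_mono mult_right_mono) auto
      finally show ?thesis by (simp add: algebra_simps)
    qed
    have "h * h * fv (x + s *\<^sub>R v + t *\<^sub>R w) w = h * h * fw (x + s' *\<^sub>R w + t' *\<^sub>R v) v"
      using st(5) st'(5) by (simp add: algebra_simps)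
    then have "fv (x + s *\<^sub>R v + t *\<^sub>R w) w = fw (x + s' *\<^sub>R w + t' *\<^sub>R v) v"
      using h by simp
    moreover have "norm (x + s *\<^sub>R v + t *\<^sub>R w - x) \<le> h * (norm v + norm w)"
      using bound[OF st(1-4), of v w] by (simp add: algebra_simps)
    moreover have "norm (x + s' *\<^sub>R w + t' *\<^sub>R v - x) \<le> h * (norm v + norm w)"
      using bound[OF st'(1-4), of w v] by (simp add: algebra_simps)
    ultimately show ?thesis by blast
  qed
  define h :: "nat \<Rightarrow> real" where "h n = 1 / Suc n" for n
  have hpos: "h n > 0" for n by (simp add: h_def)
  have "\<forall>n. \<exists>p q. norm (p - x) \<le> h n * (norm v + norm w) \<and> norm (q - x) \<le> h n * (norm v + norm w)
      \<and> fv p w = fw q v"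
    using close[OF hpos] by simp
  then obtain p q where p: "\<And>n. norm (p n - x) \<le> h n * (norm v + norm w)"
    and q: "\<And>n. norm (q n - x) \<le> h n * (norm v + norm w)"
    and eq: "\<And>n. fv (p n) w = fw (q n) v"
    by metis
  have h0: "(\<lambda>n. h n * (norm v + norm w)) \<longlonglongrightarrow> 0"
    unfolding h_def by (rule tendsto_mult_left_zero) (rule lim_1_over_n[THEN LIMSEQ_Suc])
  have "(\<lambda>n. p n - x) \<longlonglongrightarrow> 0" "(\<lambda>n. q n - x) \<longlonglongrightarrow> 0"
    by (rule Lim_null_comparison[OF _ h0]; simp add: p q)+
  then have "p \<longlonglongrightarrow> x" "q \<longlonglongrightarrow> x"
    by (simp_all add: LIM_zero_iff)
  then have "(\<lambda>n. fv (p n) w) \<longlonglongrightarrow> fv x w" "(\<lambda>n. fw (q n) v) \<longlonglongrightarrow> fw x v"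
    using isCont_tendsto_compose[OF cv] isCont_tendsto_compose[OF cw] by auto
  then show ?thesis
    unfolding eq by (rule LIMSEQ_unique)
qed

lemma differentiable_entrywise:
  fixes f :: "'a::real_normed_vector \<Rightarrow> 'b::euclidean_space^'n"
  assumes "\<And>i. (\<lambda>y. f y $ i) differentiable F"
  shows "f differentiable F"
proof -
  have "\<forall>i. \<exists>D. ((\<lambda>y. f y $ i) has_derivative D) F"
    using assms by (simp add: differentiable_def)
  then obtain D where D: "\<And>i. ((\<lambda>y. f y $ i) has_derivative D i) F"
    by metis
  have axis_bl: "bounded_linear (axis i :: 'b \<Rightarrow> 'b^'n)" for i
    by (intro linear_conv_bounded_linear[THEN iffD1] linearI) (auto simp: vec_eq_iff axis_def)
  have "((\<lambda>y. \<Sum>i\<in>UNIV. axis i (f y $ i)) has_derivative (\<lambda>d. \<Sum>i\<in>UNIV. axis i (D i d))) F"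
    by (intro has_derivative_sum bounded_linear.has_derivative[OF axis_bl] D)
  moreover have "(\<lambda>y. \<Sum>i\<in>UNIV. axis i (f y $ i)) = f"
    by (simp add: fun_eq_iff vec_eq_iff axis_def)
  ultimately show ?thesis
    unfolding differentiable_def by auto
qed

lemma smooth_derivatives:
  fixes E :: "real^'n \<Rightarrow> real"
  assumes "smooth_on UNIV E"
  shows "E differentiable (at x)"
    and "(\<lambda>y. frechet_derivative E (at y) v) differentiable (at x)"
    and "(\<lambda>y. frechet_derivative (\<lambda>z. frechet_derivative E (at z) v) (at y) w) differentiable (at x)"
proof -
  have "Ck_on 3 UNIV E"
    using assms by (simp add: smooth_on_def)
  then have "Ck_on (Suc (Suc (Suc 0))) UNIV E"
    by (simp add: numeral_3_eq_3)
  then show "E differentiable (at x)"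
    "(\<lambda>y. frechet_derivative E (at y) v) differentiable (at x)"
    "(\<lambda>y. frechet_derivative (\<lambda>z. frechet_derivative E (at z) v) (at y) w) differentiable (at x)"
    by simp_all
qed

lemma grad_has_derivative:
  fixes E :: "real^'n \<Rightarrow> real"
  assumes "smooth_on UNIV E"
  shows "(grad E has_derivative (\<lambda>u. hessian E x *v u)) (at x)"
proof -
  have "grad E differentiable (at x)"
    by (rule differentiable_entrywise) (simp add: grad_def smooth_derivatives(2)[OF assms])
  then show ?thesis
    by (simp add: jacobian_works hessian_def)
qed

lemma hessian_entry:
  fixes E :: "real^'n \<Rightarrow> real"
  assumes "smooth_on UNIV E"
  shows "hessian E x $ i $ j =
    frechet_derivative (\<lambda>y. frechet_derivative E (at y) (axis i 1)) (at x) (axis j 1)"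
proof -
  have "((\<lambda>y. grad E y $ i) has_derivative (\<lambda>u. (hessian E x *v u) $ i)) (at x)"
    by (rule bounded_linear.has_derivative[OF bounded_linear_vec_nth grad_has_derivative[OF assms]])
  from frechet_derivative_at[OF this]
  have "(hessian E x *v axis j 1) $ i =
      frechet_derivative (\<lambda>y. frechet_derivative E (at y) (axis i 1)) (at x) (axis j 1)"
    by (simp add: grad_def fun_eq_iff)
  then show ?thesis
    by (simp add: matrix_vector_mult_basis column_def)
qed

lemma hessian_symmetric:
  fixes E :: "real^'n \<Rightarrow> real"
  assumes "smooth_on UNIV E"
  shows "transpose (hessian E x) = hessian E x"
proof -
  note D = smooth_derivatives[OF assms]
  have "hessian E x $ i $ j = hessian E x $ j $ i" for i j
    unfolding hessian_entry[OF assms]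
    by (rule mixed_derivatives_commute[of E "\<lambda>y. frechet_derivative E (at y)"
          "axis i 1" "\<lambda>y. frechet_derivative (\<lambda>z. frechet_derivative E (at z) (axis i 1)) (at y)"
          "axis j 1" "\<lambda>y. frechet_derivative (\<lambda>z. frechet_derivative E (at z) (axis j 1)) (at y)"])
      (intro D differentiable_imp_continuous_within frechet_derivative_works[THEN iffD1])+
  then show ?thesis
    by (simp add: transpose_def vec_eq_iff)
qed

lemma hessian_differentiable:
  fixes E :: "real^'n \<Rightarrow> real"
  assumes "smooth_on UNIV E"
  shows "hessian E differentiable (at x)"
  by (intro differentiable_entrywise) (simp add: hessian_entry[OF assms] smooth_derivatives(3)[OF assms])

text \<open>
  Differentiating \<open>transpose \<circ> hessian E = hessian E\<close> makes this a third-order consequence of the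
  symmetry of mixed second derivatives.
\<close>

lemma hessian_derivative_symmetric:
  fixes E :: "real^'n \<Rightarrow> real"
  assumes E: "smooth_on UNIV E" and DH: "(hessian E has_derivative DH) (at x)"
  shows "transpose (DH u) = DH u"
proof -
  have "((\<lambda>y. transpose (hessian E y)) has_derivative (\<lambda>u. transpose (DH u))) (at x)"
    by (rule bounded_linear.has_derivative[OF linear_transpose[unfolded linear_conv_bounded_linear] DH])
  then have "(hessian E has_derivative (\<lambda>u. transpose (DH u))) (at x)"
    by (simp add: hessian_symmetric[OF E])
  from has_derivative_unique[OF this DH] show ?thesis
    by (simp add: fun_eq_iff)
qed

section \<open>Orthonormal eigenframes\<close>

text \<open>
  When the eigenvalues are distinct, they can index an orthonormal eigenbasis themselves: \<open>e l\<close> is a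
  unit eigenvector for \<open>l\<close>. The last clause says that the \<open>e l\<close> span the space.
\<close>

definition eigenframe :: "real^'n^'n \<Rightarrow> (real \<Rightarrow> real^'n) \<Rightarrow> bool" where
  "eigenframe A e \<longleftrightarrow> finite (eigenvalues A) \<and>
     (\<forall>l\<in>eigenvalues A. A *v e l = l *\<^sub>R e l) \<and>
     (\<forall>l\<in>eigenvalues A. \<forall>m\<in>eigenvalues A. e l \<bullet> e m = (if l = m then 1 else 0)) \<and>
     (\<forall>v. v = (\<Sum>l\<in>eigenvalues A. (v \<bullet> e l) *\<^sub>R e l))"

text \<open>
  Eigenvectors of a symmetric matrix for different eigenvalues are orthogonal, and here there are as
  many of them as the dimension, so they span.
\<close>

lemma eigenframe_exists:
  fixes A :: "real^'n^'n"
  assumes sym: "transpose A = A" and dist: "distinct_eigenvalues A"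
  obtains e where "eigenframe A e"
proof -
  let ?L = "eigenvalues A"
  have fin: "finite ?L"
    using dist zero_less_card_finite[where 'a='n] unfolding distinct_eigenvalues_def
    by (metis card.infinite less_irrefl)
  have "\<forall>l\<in>?L. \<exists>v. norm v = 1 \<and> A *v v = l *\<^sub>R v"
  proof
    fix l assume "l \<in> ?L"
    then obtain v where v: "v \<noteq> 0" "A *v v = l *\<^sub>R v"
      by (auto simp: eigenvalues_def)
    then show "\<exists>v. norm v = 1 \<and> A *v v = l *\<^sub>R v"
      by (intro exI[of _ "v /\<^sub>R norm v"]) (simp add: mv.scaleR_right mult.commute)
  qed
  then obtain e where e: "\<And>l. l \<in> ?L \<Longrightarrow> norm (e l) = 1" "\<And>l. l \<in> ?L \<Longrightarrow> A *v e l = l *\<^sub>R e l"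
    by metis
  have orth: "e l \<bullet> e m = (if l = m then 1 else 0)" if "l \<in> ?L" "m \<in> ?L" for l m
  proof (cases "l = m")
    case True
    then show ?thesis
      using e(1)[OF that(1)] by (simp add: norm_eq_1)
  next
    case False
    have "l * (e l \<bullet> e m) = m * (e l \<bullet> e m)"
      using symmetric_matrix_inner[OF sym, of "e l" "e m"] e(2) that by simp
    with False show ?thesis by simp
  qed
  have inj: "inj_on e ?L"
    by (rule inj_onI) (metis orth zero_neq_one)
  have "independent (e ` ?L)"
  proof (rule pairwise_orthogonal_independent)
    show "pairwise orthogonal (e ` ?L)"
      using orth by (auto simp: pairwise_def orthogonal_def)
    show "0 \<notin> e ` ?L"
      using e(1) by fastforce
  qed
  then have spn: "UNIV \<subseteq> span (e ` ?L)"
    using card_ge_dim_independent[of "e ` ?L" UNIV] dist card_image[OF inj]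
    by (simp add: distinct_eigenvalues_def)
  have "v = (\<Sum>l\<in>?L. (v \<bullet> e l) *\<^sub>R e l)" for v
  proof -
    define w where "w = v - (\<Sum>l\<in>?L. (v \<bullet> e l) *\<^sub>R e l)"
    have "w \<bullet> e m = 0" if "m \<in> ?L" for m
    proof -
      have "(\<Sum>l\<in>?L. (v \<bullet> e l) * (e l \<bullet> e m)) = (\<Sum>l\<in>?L. if l = m then v \<bullet> e m else 0)"
        using orth that by (intro sum.cong) auto
      then show ?thesis
        using that fin by (simp add: w_def inner_diff_left inner_sum_left)
    qed
    then have "orthogonal w y" if "y \<in> span (e ` ?L)" for y
      using orthogonal_to_span[OF that, of w] by (auto simp: orthogonal_def)
    then have "orthogonal w w"
      using spn by blast
    then show ?thesis
      by (simp add: w_def orthogonal_def)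
  qed
  then have "eigenframe A e"
    unfolding eigenframe_def using fin e(2) orth by (intro conjI ballI allI)
  then show thesis by (rule that)
qed

context
  fixes A :: "real^'n^'n" and e :: "real \<Rightarrow> real^'n"
  assumes frame: "eigenframe A e"
begin

lemma eigenframe_finite: "finite (eigenvalues A)"
  using frame unfolding eigenframe_def by (elim conjE)

lemma eigenframe_eigenvector: "l \<in> eigenvalues A \<Longrightarrow> A *v e l = l *\<^sub>R e l"
  using frame unfolding eigenframe_def by (elim conjE) (rule bspec)

lemma eigenframe_inner:
  "l \<in> eigenvalues A \<Longrightarrow> m \<in> eigenvalues A \<Longrightarrow> e l \<bullet> e m = (if l = m then 1 else 0)"
  using frame unfolding eigenframe_def by (elim conjE) (drule (1) bspec, drule (1) bspec)

lemma eigenframe_expand: "v = (\<Sum>l\<in>eigenvalues A. (v \<bullet> e l) *\<^sub>R e l)"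
  using frame unfolding eigenframe_def by (elim conjE) (rule spec)

lemma eigenframe_nonzero: "l \<in> eigenvalues A \<Longrightarrow> e l \<noteq> 0"
  using eigenframe_inner[of l l] by auto

lemma eigenframe_eqI:
  assumes "\<And>l. l \<in> eigenvalues A \<Longrightarrow> v \<bullet> e l = w \<bullet> e l"
  shows "v = w"
  by (subst eigenframe_expand[of v], subst eigenframe_expand[of w]) (simp add: assms)

lemma eigenframe_parseval: "v \<bullet> w = (\<Sum>l\<in>eigenvalues A. (v \<bullet> e l) * (w \<bullet> e l))"
proof -
  have "v \<bullet> w = (\<Sum>l\<in>eigenvalues A. (v \<bullet> e l) *\<^sub>R e l) \<bullet> w"
    by (rule arg_cong[OF eigenframe_expand[of v], of "\<lambda>x. x \<bullet> w"])
  also have "\<dots> = (\<Sum>l\<in>eigenvalues A. (v \<bullet> e l) * (w \<bullet> e l))"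
    unfolding inner_sum_left inner_scaleR_left by (simp only: inner_commute[of "e _" w])
  finally show ?thesis .
qed

lemma dim_span_eigenframe:
  assumes "M \<subseteq> eigenvalues A"
  shows "dim (span (e ` M)) = card M"
proof -
  have inj: "inj_on e M"
    by (rule inj_onI) (metis assms subsetD eigenframe_inner zero_neq_one)
  have "independent (e ` M)"
  proof (rule pairwise_orthogonal_independent)
    show "pairwise orthogonal (e ` M)"
      using assms by (auto simp: pairwise_def orthogonal_def) (metis eigenframe_inner subsetD)
    show "0 \<notin> e ` M"
      using assms eigenframe_nonzero by auto
  qed
  then show ?thesis
    by (simp add: dim_span_eq_card_independent card_image[OF inj] del: dim_span)
qed

context
  assumes sym: "transpose A = A"
begin

lemma eigenspace_eigenframe:
  assumes l: "l \<in> eigenvalues A"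
  shows "eigenspace A l = span {e l}"
proof
  show "eigenspace A l \<subseteq> span {e l}"
  proof
    fix v assume "v \<in> eigenspace A l"
    then have v: "A *v v = l *\<^sub>R v" by (simp add: eigenspace_def)
    have "v \<bullet> e m = ((v \<bullet> e l) *\<^sub>R e l) \<bullet> e m" if m: "m \<in> eigenvalues A" for m
    proof (cases "m = l")
      case True
      then show ?thesis using eigenframe_inner[OF l l] by simp
    next
      case False
      have "l * (v \<bullet> e m) = m * (v \<bullet> e m)"
        using symmetric_matrix_inner[OF sym, of v "e m"] v eigenframe_eigenvector[OF m] by simp
      with False show ?thesis using eigenframe_inner[OF l m] by simp
    qed
    then have "v = (v \<bullet> e l) *\<^sub>R e l" by (rule eigenframe_eqI)
    then show "v \<in> span {e l}"
      by (metis span_base span_mul insertI1)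
  qed
  show "span {e l} \<subseteq> eigenspace A l"
    using eigenframe_eigenvector[OF l]
    by (auto simp: span_singleton eigenspace_def mv.scaleR_right)
qed

lemma neg_index_eigenframe: "neg_index A = card {l \<in> eigenvalues A. l < 0}"
proof -
  have "dim (eigenspace A l) = 1" if "l \<in> eigenvalues A" for l
    using dim_span_eigenframe[of "{l}"] eigenspace_eigenframe that by simp
  then show ?thesis by (simp add: neg_index_def)
qed

lemma commuting_matrix_eigenframe:
  assumes R: "A ** R = R ** A" and l: "l \<in> eigenvalues A"
  obtains r where "R *v e l = r *\<^sub>R e l"
proof -
  have "A *v (R *v e l) = l *\<^sub>R (R *v e l)"
    by (metis R eigenframe_eigenvector[OF l] matrix_vector_mul_assoc mv.scaleR_right)
  then have "R *v e l \<in> span {e l}"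
    using eigenspace_eigenframe[OF l] by (auto simp: eigenspace_def)
  then show thesis
    using that by (auto simp: span_singleton)
qed

text \<open>
  A matrix commuting with \<open>A\<close> preserves the eigenspaces of \<open>A\<close>, which are lines; so the reflection is
  diagonal in the eigenframe, with a sign \<open>r l\<close> for each eigenvalue \<open>l\<close>.
\<close>

lemma commuting_involution_eigenframe:
  assumes R: "A ** R = R ** A" "R ** R = mat 1"
  obtains r where "\<And>l. l \<in> eigenvalues A \<Longrightarrow> R *v e l = r l *\<^sub>R e l"
    and "\<And>l. l \<in> eigenvalues A \<Longrightarrow> r l = 1 \<or> r l = -1"
proof -
  have "\<forall>l\<in>eigenvalues A. \<exists>r. R *v e l = r *\<^sub>R e l"
    using commuting_matrix_eigenframe[OF R(1)] by metis
  then obtain r where r: "\<And>l. l \<in> eigenvalues A \<Longrightarrow> R *v e l = r l *\<^sub>R e l"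
    by metis
  have "r l = 1 \<or> r l = -1" if l: "l \<in> eigenvalues A" for l
  proof -
    have "R *v (R *v e l) = e l"
      by (simp add: matrix_vector_mul_assoc R(2))
    then have "(r l * r l - 1) *\<^sub>R e l = 0"
      by (simp add: r[OF l] mv.scaleR_right algebra_simps)
    then have "(r l)\<^sup>2 = 1"
      using eigenframe_nonzero[OF l] by (simp add: power2_eq_square)
    then show ?thesis by (simp add: power2_eq_1_iff)
  qed
  with r show thesis by (rule that)
qed

end

end

text \<open>
  The condition on the reflection translated to signs: \<open>R\<close> must act on the eigenline of \<open>l\<close> by the sign
  of \<open>l\<close>. Since all eigenvalues are nonzero, the orthogonal complement of the positive eigenspaces is
  spanned by the negative ones.
\<close>

lemma reflection_about_positive_eigensum_iff:
  fixes A R :: "real^'n^'n"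
  assumes frame: "eigenframe A e" and symA: "transpose A = A" and nz: "0 \<notin> eigenvalues A"
    and symR: "transpose R = R" and inv: "R ** R = mat 1"
    and r: "\<And>l. l \<in> eigenvalues A \<Longrightarrow> R *v e l = r l *\<^sub>R e l"
    and r1: "\<And>l. l \<in> eigenvalues A \<Longrightarrow> r l = 1 \<or> r l = -1"
  shows "is_reflection_about R (positive_eigensum A) \<longleftrightarrow> (\<forall>l\<in>eigenvalues A. r l * l > 0)"
    (is "?refl \<longleftrightarrow> ?sgn")
proof
  assume refl: ?refl
  show ?sgn
  proof
    fix l assume l: "l \<in> eigenvalues A"
    have "l \<noteq> 0" using nz l by auto
    then consider "l > 0" | "l < 0" by linarith
    then show "r l * l > 0"
    proof cases
      case 1
      then have "e l \<in> positive_eigensum A"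
        using l eigenframe_eigenvector[OF frame l]
        by (auto simp: positive_eigensum_def eigenspace_def intro!: span_base)
      then have "R *v e l = e l"
        using refl by (simp add: is_reflection_about_def)
      then have "(r l - 1) *\<^sub>R e l = 0"
        using r[OF l] by (simp add: algebra_simps)
      then have "r l = 1"
        using eigenframe_nonzero[OF frame l] by simp
      with 1 show ?thesis by simp
    next
      case 2
      have "orthogonal (e l) y" if "y \<in> positive_eigensum A" for y
        using that unfolding positive_eigensum_def
      proof (rule orthogonal_to_span)
        fix y assume "y \<in> (\<Union>m\<in>{m \<in> eigenvalues A. m > 0}. eigenspace A m)"
        then obtain m where m: "m \<in> eigenvalues A" "m > 0" "y \<in> span {e m}"
          using eigenspace_eigenframe[OF frame symA] by auto
        then show "orthogonal (e l) y"
          using eigenframe_inner[OF frame l m(1)] 2 by (auto simp: span_singleton orthogonal_def)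
      qed
      then have "e l \<in> (positive_eigensum A)\<^sup>\<bottom>"
        by (simp add: orthogonal_comp_def orthogonal_commute)
      then have "R *v e l = - e l"
        using refl by (simp add: is_reflection_about_def)
      then have "(r l + 1) *\<^sub>R e l = 0"
        using r[OF l] by (simp add: algebra_simps)
      then have "r l = -1"
        using eigenframe_nonzero[OF frame l] by simp
      with 2 show ?thesis by simp
    qed
  qed
next
  assume sgn: ?sgn
  have rp: "r l = 1" if "l \<in> eigenvalues A" "l > 0" for l
    using sgn r1 that by fastforce
  have rn: "r l = -1" if "l \<in> eigenvalues A" "\<not> l > 0" for l
    using sgn r1 that by fastforce
  have "positive_eigensum A \<subseteq> {v. R *v v = v}"
    unfolding positive_eigensum_def
  proof (rule span_minimal)
    show "subspace {v. R *v v = v}"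
      by (simp add: subspace_def mv.add_right mv.scaleR_right)
    show "(\<Union>l\<in>{l \<in> eigenvalues A. 0 < l}. eigenspace A l) \<subseteq> {v. R *v v = v}"
      using eigenspace_eigenframe[OF frame symA] r rp
      by (auto simp: span_singleton mv.scaleR_right)
  qed
  then have "R *v v = v" if "v \<in> positive_eigensum A" for v
    using that by blast
  moreover have "R *v v = - v" if v: "v \<in> (positive_eigensum A)\<^sup>\<bottom>" for v
  proof (rule eigenframe_eqI[OF frame])
    fix l assume l: "l \<in> eigenvalues A"
    have 1: "(R *v v) \<bullet> e l = r l * (v \<bullet> e l)"
      using symmetric_matrix_inner[OF symR, of v "e l"] r[OF l] by simp
    show "(R *v v) \<bullet> e l = - v \<bullet> e l"
    proof (cases "l > 0")
      case True
      then have "e l \<in> positive_eigensum A"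
        using l eigenframe_eigenvector[OF frame l]
        by (auto simp: positive_eigensum_def eigenspace_def intro!: span_base)
      then have "v \<bullet> e l = 0"
        using v by (auto simp: orthogonal_comp_def orthogonal_def inner_commute)
      then show ?thesis by (simp add: 1)
    next
      case False
      then show ?thesis using rn[OF l] by (simp add: 1)
    qed
  qed
  moreover have "orthogonal_matrix R"
    using symR inv by (simp add: orthogonal_matrix_def)
  ultimately show ?refl
    by (simp add: is_reflection_about_def)
qed

text \<open>
  If the signs agree, both the kernel of \<open>R + I\<close> and the negative eigenspaces of \<open>A\<close> are spanned by the
  \<open>e l\<close> with \<open>l < 0\<close>. Hence a reflection in \<open>reflections k\<close> forces the Morse index to be \<open>k\<close>.
\<close>

lemma neg_index_eq_reflection_index:
  fixes A R :: "real^'n^'n"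
  assumes frame: "eigenframe A e" and symA: "transpose A = A"
    and symR: "transpose R = R"
    and r: "\<And>l. l \<in> eigenvalues A \<Longrightarrow> R *v e l = r l *\<^sub>R e l"
    and r1: "\<And>l. l \<in> eigenvalues A \<Longrightarrow> r l = 1 \<or> r l = -1"
    and sgn: "\<forall>l\<in>eigenvalues A. r l * l > 0"
  shows "neg_index A = dim {v. (R + mat 1) *v v = 0}"
proof -
  let ?N = "{l \<in> eigenvalues A. l < 0}"
  have rn: "r l = -1 \<longleftrightarrow> l < 0" if "l \<in> eigenvalues A" for l
    using sgn r1 that by fastforce
  have Rn: "R *v e l = - e l" if "l \<in> eigenvalues A" "l < 0" for l
    using r[OF that(1)] rn[OF that(1)] that(2) by simp
  have "{v. (R + mat 1) *v v = 0} = span (e ` ?N)"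
  proof
    show "{v. (R + mat 1) *v v = 0} \<subseteq> span (e ` ?N)"
    proof
      fix v assume "v \<in> {v. (R + mat 1) *v v = 0}"
      then have v: "R *v v = - v"
        by (simp add: mv.add_left eq_neg_iff_add_eq_0)
      have zero: "v \<bullet> e l = 0" if l: "l \<in> eigenvalues A" "l \<notin> ?N" for l
      proof -
        have "r l = 1" using rn[OF l(1)] r1[OF l(1)] l by auto
        then show ?thesis
          using symmetric_matrix_inner[OF symR, of v "e l"] r[OF l(1)] v by simp
      qed
      have "(v \<bullet> e l) *\<^sub>R e l \<in> span (e ` ?N)" if l: "l \<in> eigenvalues A" for l
        using zero[OF l] span_base[of "e l" "e ` ?N"]
        by (cases "l \<in> ?N") (auto intro: span_mul span_zero)
      then have "(\<Sum>l\<in>eigenvalues A. (v \<bullet> e l) *\<^sub>R e l) \<in> span (e ` ?N)"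
        by (rule span_sum)
      then show "v \<in> span (e ` ?N)"
        by (subst eigenframe_expand[OF frame, of v])
    qed
    have "subspace {v. (R + mat 1) *v v = 0}"
      by (simp add: subspace_def mv.add_right mv.scaleR_right)
    then show "span (e ` ?N) \<subseteq> {v. (R + mat 1) *v v = 0}"
      by (intro span_minimal) (auto simp: mv.add_left Rn)
  qed
  then show ?thesis
    using dim_span_eigenframe[OF frame, of ?N] neg_index_eigenframe[OF frame symA] by auto
qed

text \<open>
  In the eigenframe \<open>R ** A\<close> is diagonal with the positive entries \<open>r l * l\<close>.
\<close>

lemma commuting_frame_positive_definite:
  fixes A R :: "real^'n^'n"
  assumes frame: "eigenframe A e"
    and sym: "transpose (R ** A) = R ** A"
    and r: "\<And>l. l \<in> eigenvalues A \<Longrightarrow> R *v e l = r l *\<^sub>R e l"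
    and sgn: "\<forall>l\<in>eigenvalues A. r l * l > 0" and v: "v \<noteq> 0"
  shows "v \<bullet> ((R ** A) *v v) > 0"
proof -
  have "((R ** A) *v v) \<bullet> e l = r l * l * (v \<bullet> e l)" if l: "l \<in> eigenvalues A" for l
  proof -
    have "(R ** A) *v e l = (r l * l) *\<^sub>R e l"
      using eigenframe_eigenvector[OF frame l] r[OF l]
      by (simp add: matrix_vector_mul_assoc[symmetric] mv.scaleR_right mult.commute)
    then show ?thesis
      using symmetric_matrix_inner[OF sym, of v "e l"] by simp
  qed
  then have "v \<bullet> ((R ** A) *v v) = (\<Sum>l\<in>eigenvalues A. (r l * l) * (v \<bullet> e l)\<^sup>2)"
    by (intro trans[OF eigenframe_parseval[OF frame] sum.cong]) (simp_all add: power2_eq_square)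
  moreover obtain l where l: "l \<in> eigenvalues A" "v \<bullet> e l \<noteq> 0"
    using eigenframe_eqI[OF frame, of v 0] v by auto
  have "(\<Sum>l\<in>eigenvalues A. (r l * l) * (v \<bullet> e l)\<^sup>2) > 0"
    using l sgn by (intro sum_pos2[OF eigenframe_finite[OF frame] l(1)]) (auto intro: less_imp_le)
  ultimately show ?thesis by simp
qed

section \<open>Tangent spaces of the reflection manifolds\<close>

text \<open>
  The Lie algebra of the orthogonal group, described by velocities at the identity of curves that are
  defined for all times. Global curves can be multiplied pointwise and reparametrized linearly, which
  makes this set a subspace.
\<close>

definition rotation_velocities :: "(real^'n^'n) set" where
  "rotation_velocities = {A. \<exists>Q Q'. (\<forall>t::real. orthogonal_matrix (Q t)) \<and>
     (\<forall>t. (Q has_vector_derivative Q' t) (at t)) \<and> continuous_on UNIV Q' \<and>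
     Q 0 = mat 1 \<and> Q' 0 = A}"

lemma rotation_velocitiesI:
  assumes "\<And>t::real. orthogonal_matrix (Q t)" "\<And>t. (Q has_vector_derivative Q' t) (at t)"
    "continuous_on UNIV Q'" "Q 0 = mat 1"
  shows "Q' 0 \<in> rotation_velocities"
  using assms unfolding rotation_velocities_def by blast

lemma subspace_rotation_velocities: "subspace (rotation_velocities :: (real^'n^'n) set)"
  unfolding subspace_def
proof (intro conjI ballI allI)
  show "0 \<in> (rotation_velocities :: (real^'n^'n) set)"
    using rotation_velocitiesI[of "\<lambda>t. mat 1" "\<lambda>t. 0"] by (simp add: orthogonal_matrix_id)
next
  fix A B :: "real^'n^'n"
  assume "A \<in> rotation_velocities" "B \<in> rotation_velocities"
  then obtain Q Q' P P' :: "real \<Rightarrow> real^'n^'n" where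
    Q: "\<And>t. orthogonal_matrix (Q t)" "\<And>t. (Q has_vector_derivative Q' t) (at t)"
      "continuous_on UNIV Q'" "Q 0 = mat 1" "Q' 0 = A" and
    P: "\<And>t. orthogonal_matrix (P t)" "\<And>t. (P has_vector_derivative P' t) (at t)"
      "continuous_on UNIV P'" "P 0 = mat 1" "P' 0 = B"
    unfolding rotation_velocities_def by blast
  have cont: "continuous_on UNIV Q" "continuous_on UNIV P"
    by (rule continuous_at_imp_continuous_on, rule ballI, rule has_vector_derivative_continuous, rule Q P)+
  have "(\<lambda>t. Q t ** P' t + Q' t ** P t) 0 \<in> rotation_velocities"
  proof (rule rotation_velocitiesI[of "\<lambda>t. Q t ** P t"])
    show "((\<lambda>t. Q t ** P t) has_vector_derivative Q t ** P' t + Q' t ** P t) (at t)" for t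
      by (rule mm.has_vector_derivative[OF Q(2) P(2)])
    show "continuous_on UNIV (\<lambda>t. Q t ** P' t + Q' t ** P t)"
      by (intro continuous_intros mm.continuous_on Q P cont)
  qed (use Q P in \<open>simp_all add: orthogonal_matrix_mul\<close>)
  then show "A + B \<in> rotation_velocities"
    using Q P by (simp add: add.commute)
next
  fix c :: real and A :: "real^'n^'n"
  assume "A \<in> rotation_velocities"
  then obtain Q Q' :: "real \<Rightarrow> real^'n^'n" where
    Q: "\<And>t. orthogonal_matrix (Q t)" "\<And>t. (Q has_vector_derivative Q' t) (at t)"
      "continuous_on UNIV Q'" "Q 0 = mat 1" "Q' 0 = A"
    unfolding rotation_velocities_def by blast
  have "(\<lambda>t. c *\<^sub>R Q' (c * t)) 0 \<in> rotation_velocities"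
  proof (rule rotation_velocitiesI[of "\<lambda>t. Q (c * t)"])
    show "((\<lambda>t. Q (c * t)) has_vector_derivative c *\<^sub>R Q' (c * t)) (at t)" for t
    proof -
      have "((\<lambda>t. c * t) has_vector_derivative c) (at t)"
        by (auto intro!: derivative_eq_intros)
      from vector_diff_chain_at[OF this Q(2)] show ?thesis by (simp add: o_def)
    qed
    show "continuous_on UNIV (\<lambda>t. c *\<^sub>R Q' (c * t))"
      by (intro continuous_intros continuous_on_compose2[OF Q(3)]) auto
  qed (use Q in simp_all)
  then show "c *\<^sub>R A \<in> rotation_velocities"
    using Q by simp
qed

text \<open>
  For a skew matrix with \<open>K ** K ** K = - K\<close> the exponential series of \<open>t K\<close> collapses to the formula of
  Rodrigues, \<open>I + sin t K + (1 - cos t) K\<^sup>2\<close>, and orthogonality is the identity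
  \<open>2 (1 - cos t) - (1 - cos t)\<^sup>2 - (sin t)\<^sup>2 = 0\<close>.
\<close>

lemma rodrigues_rotation_velocity:
  fixes K :: "real^'n^'n"
  assumes skew: "transpose K = - K" and cube: "K ** K ** K = - K"
  shows "K \<in> rotation_velocities"
proof -
  define Q where "Q t = mat 1 + sin t *\<^sub>R K + (1 - cos t) *\<^sub>R (K ** K)" for t :: real
  have "(\<lambda>t. cos t *\<^sub>R K + sin t *\<^sub>R (K ** K)) 0 \<in> rotation_velocities"
  proof (rule rotation_velocitiesI[of Q])
    show "(Q has_vector_derivative cos t *\<^sub>R K + sin t *\<^sub>R (K ** K)) (at t)" for t
      unfolding Q_def has_vector_derivative_def
      by (auto intro!: derivative_eq_intros simp: algebra_simps)
    show "continuous_on UNIV (\<lambda>t. cos t *\<^sub>R K + sin t *\<^sub>R (K ** K))"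
      by (intro continuous_intros)
    show "Q 0 = mat 1" by (simp add: Q_def)
    fix t :: real
    have cube': "K ** K ** K ** K = - (K ** K)"
      by (simp add: cube mm.minus_left)
    have sin_sq: "sin t * sin t = 1 - cos t * cos t"
      using sin_cos_squared_add[of t] unfolding power2_eq_square by linarith
    have tQ: "transpose (Q t) = mat 1 - sin t *\<^sub>R K + (1 - cos t) *\<^sub>R (K ** K)"
      by (simp add: Q_def transpose_expand skew matrix_expand)
    have "transpose (Q t) ** Q t =
        mat 1 + (2 * (1 - cos t) - (1 - cos t)\<^sup>2 - (sin t)\<^sup>2) *\<^sub>R (K ** K)"
      unfolding tQ unfolding Q_def
      by (simp add: matrix_expand cube cube' power2_eq_square)
        (simp add: algebra_simps sin_sq)
    also have "2 * (1 - cos t) - (1 - cos t)\<^sup>2 - (sin t)\<^sup>2 = 0"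
      by (simp add: sin_squared_eq power2_eq_square algebra_simps)
    finally show "orthogonal_matrix (Q t)"
      by (simp add: orthogonal_matrix)
  qed
  then show ?thesis by simp
qed

text \<open>
  The infinitesimal rotation of the coordinate plane of \<open>i\<close> and \<open>j\<close>; it is \<open>0\<close> for \<open>i = j\<close>.
\<close>

definition plane_generator :: "'n \<Rightarrow> 'n \<Rightarrow> real^'n^'n" where
  "plane_generator i j = (\<chi> a b. (if a = j \<and> b = i then 1 else 0) - (if a = i \<and> b = j then 1 else 0))"

lemma plane_generator_mult:
  "plane_generator i j *v x = x $ i *\<^sub>R axis j 1 - x $ j *\<^sub>R axis i (1::real)"
proof -
  have "(\<Sum>b\<in>UNIV. ((if a = j \<and> b = i then 1 else 0) - (if a = i \<and> b = j then 1 else 0)) * x $ b)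
      = (if a = j then x $ i else 0) - (if a = i then x $ j else 0)" for a
    by (simp add: left_diff_distrib sum_subtractf if_distrib[of "\<lambda>c. c * _"] cong: if_cong)
  then show ?thesis
    by (simp add: vec_eq_iff plane_generator_def matrix_vector_mult_def axis_def)
qed

lemma plane_generator_velocity: "plane_generator i j \<in> rotation_velocities"
proof (rule rodrigues_rotation_velocity)
  show "transpose (plane_generator i j) = - plane_generator i j"
    unfolding vec_eq_iff
  proof (intro allI)
    fix a b
    have "plane_generator i j $ b $ a = - (plane_generator i j $ a $ b)"
      unfolding plane_generator_def vec_lambda_beta by (simp only: conj_commute minus_diff_eq)
    then show "transpose (plane_generator i j) $ a $ b = (- plane_generator i j) $ a $ b"
      by (simp only: transpose_def vec_lambda_beta vector_uminus_component)
  qed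
  show "plane_generator i j ** plane_generator i j ** plane_generator i j = - plane_generator i j"
    unfolding matrix_eq
  proof
    fix x :: "real^'a"
    show "(plane_generator i j ** plane_generator i j ** plane_generator i j) *v x =
        - plane_generator i j *v x"
      unfolding matrix_vector_mul_assoc[symmetric] mv.minus_left plane_generator_mult
      by (cases "i = j") (simp_all add: axis_def)
  qed
qed

text \<open>
  The plane generators span the skew matrices. The sum runs over ordered pairs and so meets every
  coordinate plane twice, whence the factor \<open>1/2\<close>.
\<close>

lemma skew_imp_rotation_velocity:
  fixes A :: "real^'n^'n"
  assumes "transpose A = - A"
  shows "A \<in> rotation_velocities"
proof -
  have skew: "A $ b $ a = - A $ a $ b" for a b
    using arg_cong[OF assms, of "\<lambda>M. M $ a $ b"] by (simp add: transpose_def)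
  have "A = (\<Sum>i\<in>UNIV. \<Sum>j\<in>UNIV. (A $ j $ i / 2) *\<^sub>R plane_generator i j)"
  proof -
    have "(\<Sum>i\<in>UNIV. \<Sum>j\<in>UNIV. (A $ j $ i / 2) *
        ((if a = j \<and> b = i then 1 else 0) - (if a = i \<and> b = j then 1 else 0))) = A $ a $ b" for a b
    proof -
      have conj: "(if P \<and> Q then 1 else 0) = (if P then if Q then 1 else 0 else 0 :: real)" for P Q
        by simp
      have "(\<Sum>i\<in>UNIV. \<Sum>j\<in>UNIV. (A $ j $ i / 2) * (if a = j \<and> b = i then 1 else 0)) = A $ a $ b / 2"
        by (simp add: conj if_distrib[of "\<lambda>c. _ * c"] cong: if_cong)
      moreover have "(\<Sum>i\<in>UNIV. \<Sum>j\<in>UNIV. (A $ j $ i / 2) * (if a = i \<and> b = j then 1 else 0)) = A $ b $ a / 2"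
        by (subst sum.swap) (simp add: conj if_distrib[of "\<lambda>c. _ * c"] cong: if_cong)
      ultimately show ?thesis
        unfolding right_diff_distrib sum_subtractf by (simp only: skew[of a b])
    qed
    then show ?thesis
      by (simp add: vec_eq_iff plane_generator_def)
  qed
  then show ?thesis
    using subspace_rotation_velocities plane_generator_velocity
    by (metis (no_types, lifting) subspace_sum subspace_scale)
qed

text \<open>
  Conjugation by \<open>Q\<close> carries the kernel of \<open>R + I\<close> injectively onto that of the conjugate.
\<close>

lemma conjugate_reflection:
  fixes R Q :: "real^'n^'n"
  assumes R: "R \<in> reflections k" and Q: "orthogonal_matrix Q"
  shows "Q ** R ** transpose Q \<in> reflections k"
proof -
  let ?c = "Q ** R ** transpose Q"
  have sym: "transpose R = R" and inv: "R ** R = mat 1" and dim: "dim {v. (R + mat 1) *v v = 0} = k"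
    using R by (auto simp: reflections_def)
  have QQ: "transpose Q ** Q = mat 1" "Q ** transpose Q = mat 1"
    using Q by (auto simp: orthogonal_matrix_def)
  have "transpose ?c = ?c"
    by (simp add: matrix_transpose_mul sym matrix_mul_assoc)
  moreover have "?c ** ?c = mat 1"
    by (metis QQ inv matrix_mul_assoc matrix_mul_rid)
  moreover have "{v. (?c + mat 1) *v v = 0} = (*v) Q ` {v. (R + mat 1) *v v = 0}"
  proof -
    have conj: "?c + mat 1 = Q ** (R + mat 1) ** transpose Q"
      by (simp add: matrix_expand QQ)
    have "(?c + mat 1) *v v = 0 \<longleftrightarrow> (R + mat 1) *v (transpose Q *v v) = 0" for v
    proof -
      have "(?c + mat 1) *v v = Q *v ((R + mat 1) *v (transpose Q *v v))"
        unfolding conj by (simp only: matrix_vector_mul_assoc matrix_mul_assoc)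
      moreover have "Q *v y = 0 \<longleftrightarrow> y = 0" for y
        by (metis QQ(1) matrix_vector_mul_assoc matrix_vector_mul_lid matrix_vector_mult_0_right)
      ultimately show ?thesis by simp
    qed
    moreover have "v = Q *v (transpose Q *v v)" "transpose Q *v (Q *v v) = v" for v
      by (simp_all only: matrix_vector_mul_assoc QQ matrix_vector_mul_lid)
    ultimately show ?thesis
      by (auto simp del: transpose_matrix_vector intro: image_eqI)
  qed
  moreover have "dim ((*v) Q ` S) = dim S" for S
  proof (rule dim_image_eq)
    show "inj_on ((*v) Q) (span S)"
      by (rule inj_onI) (metis QQ(1) matrix_vector_mul_assoc matrix_vector_mul_lid)
  qed simp
  ultimately show ?thesis
    using dim by (simp add: reflections_def)
qed

text \<open>
  Differentiating \<open>transpose R = R\<close> and \<open>R ** R = mat 1\<close> along a curve gives one inclusion. For the other,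
  conjugate \<open>R\<close> by a curve of rotations with velocity \<open>A\<close>: this stays in the same reflection manifold
  and moves \<open>R\<close> with velocity \<open>A R - R A\<close>, which is \<open>S\<close> for the skew matrix \<open>A = S R / 2\<close>.
\<close>

lemma tangent_space_reflections:
  fixes R :: "real^'n^'n"
  assumes R: "R \<in> reflections k"
  shows "tangent_space (reflections k) R = {S. transpose S = S \<and> R ** S + S ** R = 0}"
proof
  have sym: "transpose R = R" and inv: "R ** R = mat 1"
    using R by (auto simp: reflections_def)
  show "tangent_space (reflections k) R \<subseteq> {S. transpose S = S \<and> R ** S + S ** R = 0}"
  proof
    fix S assume "S \<in> tangent_space (reflections k) R"
    then obtain d c where d: "d > 0" and c: "c ` {-d<..<d} \<subseteq> reflections k" "c 0 = R"
        and cS: "(c has_vector_derivative S) (at 0)"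
      unfolding tangent_space_def by auto
    have tc: "transpose (c t) = c t" "c t ** c t = mat 1" if "t \<in> {-d<..<d}" for t
    proof -
      have "c t \<in> reflections k" using that c(1) by blast
      then show "transpose (c t) = c t" "c t ** c t = mat 1" by (simp_all add: reflections_def)
    qed
    have open0: "open {-d<..<d}" "0 \<in> {-d<..<d}" using d by auto
    have "((\<lambda>t. transpose (c t)) has_vector_derivative transpose S) (at 0)"
      using bounded_linear.has_vector_derivative[OF linear_transpose[unfolded linear_conv_bounded_linear] cS] .
    moreover have "((\<lambda>t. transpose (c t)) has_vector_derivative S) (at 0)"
      by (rule has_vector_derivative_transform_within_open[OF cS open0])
        (use tc in auto)
    ultimately have "transpose S = S"
      by (rule vector_derivative_unique_at)
    moreover have "((\<lambda>t. c t ** c t) has_vector_derivative c 0 ** S + S ** c 0) (at 0)"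
      by (rule mm.has_vector_derivative[OF cS cS])
    moreover have "((\<lambda>t. c t ** c t) has_vector_derivative 0) (at 0)"
      by (rule has_vector_derivative_transform_within_open[OF has_vector_derivative_const[of "mat 1"] open0])
        (use tc in auto)
    ultimately show "S \<in> {S. transpose S = S \<and> R ** S + S ** R = 0}"
      using vector_derivative_unique_at c(2) by blast
  qed
  show "{S. transpose S = S \<and> R ** S + S ** R = 0} \<subseteq> tangent_space (reflections k) R"
  proof
    fix S assume "S \<in> {S. transpose S = S \<and> R ** S + S ** R = 0}"
    then have S: "transpose S = S" "R ** S = - (S ** R)"
      by (auto simp: add_eq_0_iff2)
    define A where "A = (1/2) *\<^sub>R (S ** R)"
    have tA: "transpose A = - A"
      by (simp add: A_def transpose_expand S sym)
    then have "A \<in> rotation_velocities" by (rule skew_imp_rotation_velocity)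
    then obtain Q Q' :: "real \<Rightarrow> real^'n^'n" where
      Q: "\<And>t. orthogonal_matrix (Q t)" "\<And>t. (Q has_vector_derivative Q' t) (at t)"
        "continuous_on UNIV Q'" "Q 0 = mat 1" "Q' 0 = A"
      unfolding rotation_velocities_def by blast
    have cont: "continuous_on UNIV Q"
      by (rule continuous_at_imp_continuous_on, rule ballI, rule has_vector_derivative_continuous, rule Q)
    define c where "c t = Q t ** R ** transpose (Q t)" for t
    define c' where "c' t = Q t ** R ** transpose (Q' t) + Q' t ** R ** transpose (Q t)" for t
    note tr = linear_transpose[where ?'n='n and ?'m='n, unfolded linear_conv_bounded_linear]
    have dc: "(c has_vector_derivative c' t) (at t)" for t
    proof -
      have "((\<lambda>t. Q t ** R) has_vector_derivative Q' t ** R) (at t)"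
        using mm.has_vector_derivative[OF Q(2) has_vector_derivative_const[of R]] by simp
      from mm.has_vector_derivative[OF this bounded_linear.has_vector_derivative[OF tr Q(2)]]
      show ?thesis unfolding c_def c'_def .
    qed
    have cc': "continuous_on X c'" for X
      unfolding c'_def
      by (intro continuous_intros mm.continuous_on bounded_linear.continuous_on[OF tr]
          continuous_on_subset[OF Q(3)] continuous_on_subset[OF cont]) auto
    have "c' 0 = A ** R - R ** A"
      by (simp add: c'_def Q tA mm.minus_right)
    also have "\<dots> = S"
      by (simp add: A_def matrix_expand S mm.minus_left scaleR_add_left[symmetric]
          matrix_mul_assoc[symmetric] inv)
    finally have c'0: "c' 0 = S" .
    have "c C1_differentiable_on {-1<..<1}"
      unfolding C1_differentiable_on_def using dc cc' by blast
    moreover have "c ` {-1<..<1} \<subseteq> reflections k"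
      using conjugate_reflection[OF R Q(1)] by (auto simp: c_def)
    moreover have "c 0 = R" by (simp add: c_def Q)
    moreover have "(c has_vector_derivative S) (at 0)" using dc[of 0] c'0 by simp
    ultimately show "S \<in> tangent_space (reflections k) R"
      unfolding tangent_space_def
      by (intro CollectI exI[of _ 1] conjI exI[of _ c]) auto
  qed
qed

section \<open>Linearization of the field\<close>

text \<open>
  At a stationary point every term containing \<open>grad E x\<close> drops out, so the \<open>x\<close> component depends only on
  the variation \<open>u\<close>, and the \<open>\<alpha>\<close> component only on \<open>a\<close>: the linearization is block triangular.
\<close>

lemma ihisd_field_has_derivative:
  fixes E :: "real^'n \<Rightarrow> real"
  assumes E: "smooth_on UNIV E" and g0: "grad E x = 0"
    and DH: "(hessian E has_derivative DH) (at x)"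
    and de: "(\<epsilon> has_real_derivative e') (at \<alpha> within {0..1})"
  shows "(ihisd_field E \<beta> \<gamma> \<sigma> \<epsilon> has_derivative
      (\<lambda>(u, S, a). (\<beta> *\<^sub>R (((- \<alpha>) *\<^sub>R R + (\<sigma> * (1 - \<alpha>)) *\<^sub>R mat 1) *v (hessian E x *v u)),
         \<gamma> *\<^sub>R (DH u - (S ** hessian E x ** R + R ** DH u ** R + R ** hessian E x ** S)),
         e' * a)))
    (at (x, R, \<alpha>) within UNIV \<times> UNIV \<times> {0..1})"
proof -
  let ?F = "at (x, R, \<alpha>) within UNIV \<times> UNIV \<times> {0..1::real}"
  have g: "((\<lambda>p. grad E (fst p)) has_derivative (\<lambda>q. hessian E x *v fst q)) ?F"
    by (rule has_derivative_compose[OF has_derivative_fst[OF has_derivative_ident]])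
      (simp add: grad_has_derivative[OF E])
  have h: "((\<lambda>p. hessian E (fst p)) has_derivative (\<lambda>q. DH (fst q))) ?F"
    by (rule has_derivative_compose[OF has_derivative_fst[OF has_derivative_ident]]) (simp add: DH)
  have R: "((\<lambda>p. fst (snd p)) has_derivative (\<lambda>q. fst (snd q))) ?F"
    and a: "((\<lambda>p. snd (snd p)) has_derivative (\<lambda>q. snd (snd q))) ?F"
    by (auto intro!: derivative_eq_intros)
  have "((\<lambda>p. \<epsilon> (snd (snd p))) has_derivative (\<lambda>q. e' * snd (snd q))) ?F"
  proof (rule has_derivative_in_compose[OF a])
    have "(\<lambda>p. snd (snd p)) ` (UNIV \<times> UNIV \<times> {0..1::real} :: ((real^'n) \<times> (real^'n^'n) \<times> real) set) \<subseteq> {0..1}"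
      by auto
    then show "(\<epsilon> has_derivative (\<lambda>d. e' * d)) (at (snd (snd (x, R, \<alpha>))) within
        (\<lambda>p. snd (snd p)) ` (UNIV \<times> UNIV \<times> {0..1} :: ((real^'n) \<times> (real^'n^'n) \<times> real) set))"
      using has_derivative_subset[OF de[unfolded has_field_derivative_def]] by simp
  qed
  moreover have "((\<lambda>p. (- snd (snd p)) *\<^sub>R fst (snd p) + (\<sigma> * (1 - snd (snd p))) *\<^sub>R (mat 1 :: real^'n^'n))
      has_derivative (\<lambda>q. (- \<alpha>) *\<^sub>R fst (snd q) + (- snd (snd q)) *\<^sub>R R
        + (\<sigma> * (0 - snd (snd q))) *\<^sub>R mat 1)) ?F"
    using R a by (auto intro!: derivative_eq_intros)
  note M = this
  have "((\<lambda>p. \<beta> *\<^sub>R (((- snd (snd p)) *\<^sub>R fst (snd p) + (\<sigma> * (1 - snd (snd p))) *\<^sub>R mat 1) *v grad E (fst p)))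
      has_derivative (\<lambda>q. \<beta> *\<^sub>R (((- \<alpha>) *\<^sub>R R + (\<sigma> * (1 - \<alpha>)) *\<^sub>R mat 1) *v (hessian E x *v fst q)))) ?F"
    by (rule has_derivative_eq_rhs[OF has_derivative_scaleR_right[OF mv.FDERIV[OF M g]]])
      (simp add: g0)
  moreover have "((\<lambda>p. \<gamma> *\<^sub>R (hessian E (fst p) - fst (snd p) ** hessian E (fst p) ** fst (snd p)))
      has_derivative (\<lambda>q. \<gamma> *\<^sub>R (DH (fst q) - (fst (snd q) ** hessian E x ** R
        + R ** DH (fst q) ** R + R ** hessian E x ** fst (snd q))))) ?F"
    by (rule has_derivative_eq_rhs[OF has_derivative_scaleR_right[OF has_derivative_diff[OF h
          mm.FDERIV[OF mm.FDERIV[OF R h] R]]]])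
      (simp add: mm.add_left algebra_simps)
  ultimately show ?thesis
    unfolding ihisd_field_def case_prod_unfold by (intro has_derivative_Pair)
qed

text \<open>
  A derivative within \<open>UNIV \<times> UNIV \<times> {0..1}\<close> is unique because in each coordinate direction the set
  contains points arbitrarily close to the base point.
\<close>

lemma ihisd_jacobian_eq:
  fixes E :: "real^'n \<Rightarrow> real" and R :: "real^'n^'n"
  assumes \<alpha>: "\<alpha> \<in> {0..1}"
    and D: "(ihisd_field E \<beta> \<gamma> \<sigma> \<epsilon> has_derivative J) (at (x, R, \<alpha>) within UNIV \<times> UNIV \<times> {0..1})"
  shows "ihisd_jacobian E \<beta> \<gamma> \<sigma> \<epsilon> (x, R, \<alpha>) = J"
proof (rule frechet_derivative_unique_within)
  show "(ihisd_field E \<beta> \<gamma> \<sigma> \<epsilon> has_derivative J) (at (x, R, \<alpha>) within UNIV \<times> UNIV \<times> {0..1})"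
    by (rule D)
  show "(ihisd_field E \<beta> \<gamma> \<sigma> \<epsilon> has_derivative ihisd_jacobian E \<beta> \<gamma> \<sigma> \<epsilon> (x, R, \<alpha>))
      (at (x, R, \<alpha>) within UNIV \<times> UNIV \<times> {0..1})"
    unfolding ihisd_jacobian_def using D frechet_derivative_works differentiable_def by blast
next
  fix i :: "(real^'n) \<times> (real^'n^'n) \<times> real" and d :: real
  assume i: "i \<in> Basis" and d: "d > 0"
  have "snd (snd i) \<in> {0, 1}"
    using i by (auto simp: Basis_prod_def)
  \<comment> \<open>a small step of the third coordinate, pointing into the interval\<close>
  moreover define s where "s = (if \<alpha> < 1 then min (d/2) (1 - \<alpha>) else - min (d/2) 1)"
  have "\<alpha> + s \<in> {0..1}" "0 < \<bar>s\<bar>" "\<bar>s\<bar> < d"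
    using \<alpha> d by (auto simp: s_def)
  ultimately show "\<exists>s. 0 < \<bar>s\<bar> \<and> \<bar>s\<bar> < d \<and> (x, R, \<alpha>) + s *\<^sub>R i \<in> UNIV \<times> UNIV \<times> {0..1}"
    using \<alpha> by (intro exI[of _ s]) (auto simp: mem_Times_iff)
qed

lemma admissible_rate_zeros:
  assumes "admissible_rate \<epsilon>" "\<alpha> \<in> {0..1}"
  shows "\<epsilon> \<alpha> = 0 \<longleftrightarrow> \<alpha> \<in> {0, 1}"
proof -
  obtain C1 C2 where C: "C1 > 0" "C2 > 0"
    and b: "C1 * (\<alpha> * (1 - \<alpha>)) \<le> \<epsilon> \<alpha>" "\<epsilon> \<alpha> \<le> C2 * (\<alpha> * (1 - \<alpha>))"
    using assms unfolding admissible_rate_def by blast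
  have "\<alpha> * (1 - \<alpha>) > 0" if "\<alpha> \<notin> {0, 1}"
    using that assms(2) by auto
  then have "C1 * (\<alpha> * (1 - \<alpha>)) > 0" if "\<alpha> \<notin> {0, 1}"
    using that C by simp
  moreover have "\<epsilon> \<alpha> = 0" if "\<alpha> \<in> {0, 1}"
    using b that by auto
  ultimately show ?thesis
    using b(1) by fastforce
qed

text \<open>
  The lower bound \<open>C\<^sub>1 \<alpha> (1 - \<alpha>) \<le> \<epsilon> \<alpha>\<close> survives in the difference quotients at both ends, where \<open>\<epsilon>\<close>
  vanishes: \<open>\<epsilon>\<close> grows at \<open>0\<close> and decreases towards \<open>1\<close> at positive speed.
\<close>

lemma admissible_rate_derivative:
  assumes "admissible_rate \<epsilon>"
  obtains d0 d1 where "(\<epsilon> has_real_derivative d0) (at 0 within {0..1})" "d0 > 0"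
    "(\<epsilon> has_real_derivative d1) (at 1 within {0..1})" "d1 < 0"
proof -
  obtain C where C: "C > 0" and b: "\<And>\<alpha>. \<alpha> \<in> {0..1} \<Longrightarrow> C * (\<alpha> * (1 - \<alpha>)) \<le> \<epsilon> \<alpha>"
    using assms unfolding admissible_rate_def by blast
  have z: "\<epsilon> 0 = 0" "\<epsilon> 1 = 0"
    using admissible_rate_zeros[OF assms] by auto
  have "Ck_on (Suc 0) {0..1} \<epsilon>"
    using assms by (simp add: admissible_rate_def smooth_on_def)
  then have "\<epsilon> differentiable (at a within {0..1})" if "a \<in> {0..1}" for a
    using that by simp
  then obtain d0 d1 where d0: "(\<epsilon> has_real_derivative d0) (at 0 within {0..1})"
    and d1: "(\<epsilon> has_real_derivative d1) (at 1 within {0..1})"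
    unfolding real_differentiable_def by (metis atLeastAtMost_iff order_refl zero_le_one)
  have nt: "at 0 within {0..1::real} \<noteq> bot" "at 1 within {0..1::real} \<noteq> bot"
    by (simp_all add: trivial_limit_within islimpt_Icc)
  have "C * (1 - 0) \<le> d0"
  proof (rule tendsto_le[OF nt(1)])
    show "((\<lambda>y. (\<epsilon> y - \<epsilon> 0) / (y - 0)) \<longlongrightarrow> d0) (at 0 within {0..1})"
      using d0 by (simp add: has_field_derivative_iff)
    show "((\<lambda>y. C * (1 - y)) \<longlongrightarrow> C * (1 - 0)) (at 0 within {0..1})"
      by (intro tendsto_intros)
    show "\<forall>\<^sub>F y in at 0 within {0..1}. C * (1 - y) \<le> (\<epsilon> y - \<epsilon> 0) / (y - 0)"
      unfolding eventually_at_filter using b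
      by (intro always_eventually) (auto simp: z field_simps less_eq_real_def)
  qed
  moreover have "d1 \<le> - (C * 1)"
  proof (rule tendsto_le[OF nt(2)])
    show "((\<lambda>y. (\<epsilon> y - \<epsilon> 1) / (y - 1)) \<longlongrightarrow> d1) (at 1 within {0..1})"
      using d1 by (simp add: has_field_derivative_iff)
    show "((\<lambda>y. - (C * y)) \<longlongrightarrow> - (C * 1)) (at 1 within {0..1})"
      by (intro tendsto_intros)
    have "(\<epsilon> y - \<epsilon> 1) / (y - 1) \<le> - (C * y)" if "y \<in> {0..1}" "y \<noteq> 1" for y
      using b[OF that(1)] that by (simp add: z divide_le_eq algebra_simps)
    then show "\<forall>\<^sub>F y in at 1 within {0..1}. (\<epsilon> y - \<epsilon> 1) / (y - 1) \<le> - (C * y)"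
      unfolding eventually_at_filter by (intro always_eventually) auto
  qed
  ultimately show thesis
    using that[OF d0 _ d1] C by auto
qed

text \<open>
  The linearized \<open>R\<close> equation maps into the tangent space. Everything follows by moving \<open>R\<close> to the left
  with \<open>S R = - R S\<close>, \<open>H R = R H\<close> and cancelling \<open>R R = I\<close>.
\<close>

lemma linearized_reflection_flow_tangent:
  fixes H R S D :: "real^'n^'n"
  assumes "transpose H = H" "transpose R = R" "R ** R = mat 1" "H ** R = R ** H"
    and "transpose D = D" "transpose S = S" "R ** S + S ** R = 0"
    and N: "N = D - (S ** H ** R + R ** D ** R + R ** H ** S)"
  shows "transpose N = N" "R ** N + N ** R = 0"
proof -
  note sym = assms(1,2,5,6) and inv = assms(3) and comm = assms(4)
  show "transpose N = N"
    unfolding N by (simp add: transpose_expand sym matrix_mul_assoc algebra_simps)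
  have invL: "X ** R ** R = X" for X
    by (simp add: matrix_mul_assoc[symmetric] inv)
  have commL: "X ** H ** R = X ** R ** H" for X
    by (simp add: matrix_mul_assoc[symmetric] comm)
  have SR: "S ** R = - (R ** S)"
    using assms(7) by (simp add: add_eq_0_iff)
  have SRL: "X ** S ** R = - (X ** R ** S)" for X
    by (metis SR matrix_mul_assoc mm.minus_right)
  show "R ** N + N ** R = 0"
    unfolding N by (simp add: matrix_expand inv invL comm commL SR SRL)
qed

section \<open>Spectra of block triangular maps\<close>

text \<open>
  A functional with \<open>\<phi> \<circ> J = \<mu> \<phi>\<close> vanishes on the range of \<open>J - \<mu>\<close>; so \<open>J - \<mu>\<close> is not surjective on \<open>T\<close>,
  hence not injective. This passes eigenvalues of a quotient block to the whole map without solving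
  for the remaining components of the eigenvector.
\<close>

lemma left_eigenvector_imp_eigenvector:
  fixes J :: "'a::euclidean_space \<Rightarrow> 'a" and \<phi> :: "'a \<Rightarrow> real"
  assumes J: "linear J" and T: "subspace T" and JT: "J ` T \<subseteq> T"
    and \<phi>: "linear \<phi>" and left: "\<And>p. p \<in> T \<Longrightarrow> \<phi> (J p) = \<mu> * \<phi> p"
    and q: "q \<in> T" "\<phi> q \<noteq> 0"
  obtains p where "p \<in> T" "p \<noteq> 0" "J p = \<mu> *\<^sub>R p"
proof -
  define K where "K p = J p - \<mu> *\<^sub>R p" for p
  have K: "linear K"
    unfolding K_def using J by (intro linear_compose_sub linear_scale_self)
  have KT: "K ` T \<subseteq> T"
    using JT T by (auto simp: K_def intro!: subspace_diff subspace_scale)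
  have "\<phi> (K p) = 0" if "p \<in> T" for p
    using left[OF that] by (simp add: K_def linear_diff[OF \<phi>] linear_cmul[OF \<phi>])
  then have "K ` T \<noteq> T" using q by (metis imageE)
  then have "dim (K ` T) \<noteq> dim T"
    using subspace_dim_equal[OF linear_subspace_image[OF K T] T KT] by auto
  then have "\<not> inj_on K (span T)"
    using dim_image_eq[OF K] by blast
  then have "\<not> inj_on K T"
    using T by (simp add: span_eq_iff[THEN iffD2])
  then obtain p p' where p: "p \<in> T" "p' \<in> T" "p \<noteq> p'" "K p = K p'"
    by (auto simp: inj_on_def)
  then have "K (p - p') = 0" by (simp add: linear_diff[OF K])
  with p show thesis
    using that[of "p - p'"] T by (simp add: K_def subspace_diff)
qed

lemma complex_eigenvalue_on_real:
  assumes "p \<in> T" "p \<noteq> 0" "J p = \<mu> *\<^sub>R p" "0 \<in> T" "J 0 = 0"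
  shows "complex_eigenvalue_on T J (complex_of_real \<mu>)"
  unfolding complex_eigenvalue_on_def using assms
  by (intro bexI[of _ p] bexI[of _ 0]) auto

text \<open>
  For an eigenvector \<open>u + i v\<close> with eigenvalue \<open>a + i b\<close> the imaginary part cancels in
  \<open>u \<bullet> L u + v \<bullet> L v = a (u \<bullet> u + v \<bullet> v)\<close>, whose left-hand side is negative.
\<close>

lemma negative_definite_eigenvalue:
  fixes u v :: "'a::real_inner"
  assumes neg: "\<And>w. w \<noteq> 0 \<Longrightarrow> w \<bullet> L w < 0"
    and eig: "L u = a *\<^sub>R u - b *\<^sub>R v" "L v = b *\<^sub>R u + a *\<^sub>R v"
    and a: "a \<ge> 0"
  shows "u = 0 \<and> v = 0"
proof (rule ccontr)
  assume nz: "\<not> (u = 0 \<and> v = 0)"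
  have *: "u \<bullet> L u + v \<bullet> L v = a * (u \<bullet> u + v \<bullet> v)"
    unfolding eig by (simp add: inner_add_right inner_diff_right inner_commute algebra_simps)
  have "u \<bullet> L u \<le> 0 \<and> v \<bullet> L v \<le> 0"
  proof -
    have "w \<bullet> L w \<le> 0" if "w \<in> {u, v}" for w
      using neg[of w] by (cases "w = 0") auto
    then show ?thesis by auto
  qed
  moreover have "u \<bullet> L u < 0 \<or> v \<bullet> L v < 0"
    using nz neg by blast
  moreover have "a * (u \<bullet> u + v \<bullet> v) \<ge> 0"
    using a by simp
  ultimately show False using * by linarith
qed

text \<open>
  The inner product is the Frobenius one. The rows of \<open>S ** K\<close> are the images of the rows of \<open>S\<close> under
  \<open>K\<close>, so \<open>S \<bullet> (S ** K)\<close> is a sum of values of the quadratic form of \<open>K\<close>; the other term is the same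
  expression for the transpose of \<open>S\<close>.
\<close>

lemma lyapunov_operator_positive:
  fixes K S :: "real^'n^'n"
  assumes sym: "transpose K = K" and pos: "\<And>v. v \<noteq> 0 \<Longrightarrow> v \<bullet> (K *v v) > 0"
    and S: "S \<noteq> 0"
  shows "S \<bullet> (S ** K + K ** S) > 0"
proof -
  have row: "(S ** K) $ i = K *v (S $ i)" for S :: "real^'n^'n" and i
  proof -
    have "K $ a $ b = K $ b $ a" for a b
      using arg_cong[OF sym, of "\<lambda>M. M $ b $ a"] by (simp add: transpose_def)
    then show ?thesis
      by (simp add: vec_eq_iff matrix_matrix_mult_def matrix_vector_mult_def mult.commute)
  qed
  have nn: "v \<bullet> (K *v v) \<ge> 0" for v
    using pos[of v] by (cases "v = 0") auto
  have ge: "S \<bullet> (S ** K) \<ge> 0" for S :: "real^'n^'n"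
    unfolding inner_vec_def[of S] row by (intro sum_nonneg nn)
  obtain i where "S $ i \<noteq> 0" using S by (auto simp: vec_eq_iff)
  then have "S \<bullet> (S ** K) > 0"
    unfolding inner_vec_def[of S] row using nn pos by (intro sum_pos2[of _ i]) auto
  moreover have "S \<bullet> (K ** S) = transpose S \<bullet> (transpose S ** K)"
    by (metis inner_transpose_matrix matrix_transpose_mul sym)
  ultimately show ?thesis
    using ge[of "transpose S"] by (simp add: inner_add_right)
qed

section \<open>Equilibria and their stability\<close>

text \<open>
  At \<open>\<alpha> = 1\<close> and \<open>\<alpha> = 0\<close> the matrix in front of the gradient is \<open>- R\<close> or \<open>\<sigma> I\<close>, hence invertible; and
  \<open>H - R H R\<close> is the commutator of \<open>H\<close> and \<open>R\<close> multiplied by the involution \<open>R\<close>.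
\<close>

lemma ihisd_equilibrium_iff:
  fixes E :: "real^'n \<Rightarrow> real"
  assumes "\<beta> > 0" "\<gamma> > 0" "\<sigma> \<in> {1, -1}" and \<epsilon>: "admissible_rate \<epsilon>"
    and R: "R \<in> reflections k" and \<alpha>: "\<alpha> \<in> {0..1}"
  shows "ihisd_equilibrium k E \<beta> \<gamma> \<sigma> \<epsilon> (x, R, \<alpha>) \<longleftrightarrow>
    grad E x = 0 \<and> hessian E x ** R = R ** hessian E x \<and> \<alpha> \<in> {0, 1}"
proof -
  let ?H = "hessian E x"
  have inv: "R ** R = mat 1" using R by (simp add: reflections_def)
  have inj: "R *v v = 0 \<longleftrightarrow> v = 0" for v
    by (metis inv matrix_vector_mul_assoc matrix_vector_mul_lid matrix_vector_mult_0_right)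
  have M: "((- \<alpha>) *\<^sub>R R + (\<sigma> * (1 - \<alpha>)) *\<^sub>R mat 1) *v v = 0 \<longleftrightarrow> v = 0" if "\<alpha> \<in> {0, 1}" for v
    using that assms(3) by (auto simp: mv.minus_left inj mv.scaleR_left)
  have comm: "?H - R ** ?H ** R = 0 \<longleftrightarrow> ?H ** R = R ** ?H"
  proof
    assume "?H - R ** ?H ** R = 0"
    then have "?H ** R = (R ** ?H ** R) ** R" by simp
    also have "\<dots> = R ** ?H" by (simp add: matrix_mul_assoc[symmetric] inv)
    finally show "?H ** R = R ** ?H" .
  next
    assume "?H ** R = R ** ?H"
    then have "R ** ?H ** R = R ** R ** ?H" by (simp add: matrix_mul_assoc[symmetric])
    then show "?H - R ** ?H ** R = 0" by (simp add: inv)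
  qed
  have "ihisd_equilibrium k E \<beta> \<gamma> \<sigma> \<epsilon> (x, R, \<alpha>) \<longleftrightarrow>
      ((- \<alpha>) *\<^sub>R R + (\<sigma> * (1 - \<alpha>)) *\<^sub>R mat 1) *v grad E x = 0 \<and> ?H - R ** ?H ** R = 0 \<and> \<epsilon> \<alpha> = 0"
    using assms by (simp add: ihisd_equilibrium_def ihisd_states_def ihisd_field_def zero_prod_def)
  then show ?thesis
    using admissible_rate_zeros[OF \<epsilon> \<alpha>] M comm by blast
qed

text \<open>
  A common eigenvector \<open>v\<close> of the Hessian and \<open>R\<close> is an eigenvector of the symmetric \<open>x\<close> block
  \<open>- \<beta> R H\<close> for \<open>- \<beta> r l\<close>. Pairing the \<open>x\<close> component with \<open>v\<close> is therefore a left eigenvector of the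
  Jacobian, so for negative \<open>r l\<close> the positive number \<open>- \<beta> r l\<close> is an eigenvalue on the tangent space.
\<close>

lemma stable_imp_sign_product_nonneg:
  fixes E :: "real^'n \<Rightarrow> real" and R :: "real^'n^'n"
  assumes E: "smooth_on UNIV E" and g0: "grad E x = 0" and comm: "hessian E x ** R = R ** hessian E x"
    and \<beta>: "\<beta> > 0" and R: "R \<in> reflections k"
    and de: "(\<epsilon> has_real_derivative d) (at 1 within {0..1})"
    and stable: "ihisd_locally_stable k E \<beta> \<gamma> \<sigma> \<epsilon> (x, R, 1)"
    and v: "v \<noteq> 0" "hessian E x *v v = l *\<^sub>R v" "R *v v = r *\<^sub>R v"
  shows "r * l \<ge> 0"
proof (rule ccontr)
  assume "\<not> r * l \<ge> 0"
  then have neg: "r * l < 0" by linarith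
  define H where "H = hessian E x"
  have symR: "transpose R = R" and inv: "R ** R = mat 1"
    using R by (auto simp: reflections_def)
  have symH: "transpose H = H"
    unfolding H_def by (rule hessian_symmetric[OF E])
  obtain DH where DH: "(hessian E has_derivative DH) (at x)"
    using hessian_differentiable[OF E] unfolding differentiable_def by blast
  define J where "J = (\<lambda>(u, S, a). (\<beta> *\<^sub>R (((- 1) *\<^sub>R R + (\<sigma> * (1 - 1)) *\<^sub>R mat 1) *v (H *v u)),
         \<gamma> *\<^sub>R (DH u - (S ** H ** R + R ** DH u ** R + R ** H ** S)), d * a))"
  have dJ: "(ihisd_field E \<beta> \<gamma> \<sigma> \<epsilon> has_derivative J) (at (x, R, 1) within UNIV \<times> UNIV \<times> {0..1})"
    unfolding J_def H_def by (rule ihisd_field_has_derivative[OF E g0 DH de])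
  have jac: "ihisd_jacobian E \<beta> \<gamma> \<sigma> \<epsilon> (x, R, 1) = J"
    by (rule ihisd_jacobian_eq[OF _ dJ]) simp
  have linJ: "linear J" by (rule has_derivative_linear[OF dJ])
  define T where "T = (UNIV :: (real^'n) set) \<times> {S. transpose S = S \<and> R ** S + S ** R = 0} \<times> (UNIV :: real set)"
  have T: "ihisd_tangent k (x, R, 1) = T"
    by (simp add: T_def ihisd_tangent_def tangent_space_reflections[OF R])
  have subT: "subspace T"
    unfolding T_def
    by (intro subspace_Times subspace_UNIV)
      (auto simp: subspace_def transpose_expand mm.add_left mm.add_right mm.scaleR_left
        mm.scaleR_right mm.zero_left mm.zero_right algebra_simps scaleR_add_right[symmetric]
        simp del: scaleR_add_right)
  have JT: "J ` T \<subseteq> T"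
  proof (clarsimp simp: T_def J_def)
    fix u S a
    assume S: "transpose S = S" "R ** S + S ** R = 0"
    define N where "N = DH u - (S ** H ** R + R ** DH u ** R + R ** H ** S)"
    note N = linearized_reflection_flow_tangent[OF symH symR inv comm[folded H_def]
        hessian_derivative_symmetric[OF E DH] S N_def]
    show "transpose (\<gamma> *\<^sub>R (DH u - (S ** H ** R + R ** DH u ** R + R ** H ** S))) =
        \<gamma> *\<^sub>R (DH u - (S ** H ** R + R ** DH u ** R + R ** H ** S)) \<and>
      R ** (\<gamma> *\<^sub>R (DH u - (S ** H ** R + R ** DH u ** R + R ** H ** S))) +
        \<gamma> *\<^sub>R (DH u - (S ** H ** R + R ** DH u ** R + R ** H ** S)) ** R = 0"
      unfolding N_def[symmetric] using N
      by (simp add: transpose_expand mm.scaleR_left mm.scaleR_right scaleR_add_right[symmetric]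
          del: scaleR_add_right)
  qed
  define \<phi> where "\<phi> p = fst p \<bullet> v" for p :: "(real^'n) \<times> (real^'n^'n) \<times> real"
  have "linear \<phi>"
    by (rule linearI) (simp_all add: \<phi>_def inner_add_left)
  moreover have "\<phi> (J p) = (- \<beta> * (r * l)) * \<phi> p" for p
  proof -
    obtain u S a where p: "p = (u, S, a)" by (cases p) auto
    have "\<phi> (J p) = - \<beta> * ((R *v (H *v u)) \<bullet> v)"
      by (simp add: p J_def \<phi>_def mv.minus_left)
    also have "(R *v (H *v u)) \<bullet> v = u \<bullet> (H *v (R *v v))"
      by (simp add: symmetric_matrix_inner[OF symR] symmetric_matrix_inner[OF symH])
    also have "H *v (R *v v) = (r * l) *\<^sub>R v"
      using v by (simp add: H_def mv.scaleR_right)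
    finally show ?thesis by (simp add: p \<phi>_def)
  qed
  moreover have "(v, 0, 0) \<in> T" "\<phi> (v, 0, 0) \<noteq> 0"
    using v(1) by (auto simp: T_def \<phi>_def transpose_expand mm.zero_left mm.zero_right)
  ultimately obtain p where "p \<in> T" "p \<noteq> 0" "J p = (- \<beta> * (r * l)) *\<^sub>R p"
    using left_eigenvector_imp_eigenvector[OF linJ subT JT] by metis
  then have "complex_eigenvalue_on T J (complex_of_real (- \<beta> * (r * l)))"
    by (rule complex_eigenvalue_on_real) (simp_all add: subspace_0[OF subT] linear_0[OF linJ])
  then have "Re (complex_of_real (- \<beta> * (r * l))) < 0"
    using stable unfolding ihisd_locally_stable_def T jac by blast
  then show False
    using mult_pos_neg[OF \<beta> neg] by simp
qed

text \<open>
  The direction of \<open>\<alpha>\<close> is an eigenvector whose eigenvalue is the derivative of the rate.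
\<close>

lemma not_stable_at_alpha_0:
  fixes E :: "real^'n \<Rightarrow> real" and R :: "real^'n^'n"
  assumes E: "smooth_on UNIV E" and g0: "grad E x = 0" and R: "R \<in> reflections k"
    and de: "(\<epsilon> has_real_derivative d) (at 0 within {0..1})" and d: "d > 0"
  shows "\<not> ihisd_locally_stable k E \<beta> \<gamma> \<sigma> \<epsilon> (x, R, 0)"
proof
  assume stable: "ihisd_locally_stable k E \<beta> \<gamma> \<sigma> \<epsilon> (x, R, 0)"
  obtain DH where DH: "(hessian E has_derivative DH) (at x)"
    using hessian_differentiable[OF E] unfolding differentiable_def by blast
  note D = ihisd_field_has_derivative[OF E g0 DH de, of \<beta> \<gamma> \<sigma> R]
  let ?J = "ihisd_jacobian E \<beta> \<gamma> \<sigma> \<epsilon> (x, R, 0)"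
  note jac = ihisd_jacobian_eq[OF _ D]
  have DH0: "DH 0 = 0"
    by (rule linear_0[OF has_derivative_linear[OF DH]])
  have "complex_eigenvalue_on (ihisd_tangent k (x, R, 0)) ?J (complex_of_real d)"
  proof (rule complex_eigenvalue_on_real)
    show "(0, 0, 1) \<in> ihisd_tangent k (x, R, 0)" "0 \<in> ihisd_tangent k (x, R, 0)"
      by (simp_all add: ihisd_tangent_def tangent_space_reflections[OF R] zero_prod_def
          transpose_expand mm.zero_left mm.zero_right)
    show "(0, 0, 1::real) \<noteq> (0 :: (real^'n) \<times> (real^'n^'n) \<times> real)"
      by (simp add: zero_prod_def)
    show "?J (0, 0, 1) = d *\<^sub>R (0, 0, 1)"
      by (simp add: jac DH0 mm.zero_left mm.zero_right)
    show "?J 0 = 0"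
      by (simp add: jac DH0 zero_prod_def mm.zero_left mm.zero_right)
  qed
  then show False
    using stable d unfolding ihisd_locally_stable_def by fastforce
qed

text \<open>
  Because \<open>R\<close> commutes with the Hessian \<open>H\<close>, the diagonal blocks at \<open>\<alpha> = 1\<close> are \<open>- \<beta> K\<close>, the Lyapunov
  operator \<open>S \<mapsto> - \<gamma> (S K + K S)\<close> and the slope of the rate, with \<open>K = R H\<close>. All three are negative
  definite, so the components \<open>x\<close>, \<open>R\<close>, \<open>\<alpha>\<close> of an eigenvector with eigenvalue of nonnegative real part
  vanish in turn.
\<close>

lemma positive_definite_imp_stable:
  fixes E :: "real^'n \<Rightarrow> real" and R :: "real^'n^'n"
  assumes E: "smooth_on UNIV E" and g0: "grad E x = 0" and comm: "hessian E x ** R = R ** hessian E x"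
    and \<beta>: "\<beta> > 0" and \<gamma>: "\<gamma> > 0" and R: "R \<in> reflections k"
    and de: "(\<epsilon> has_real_derivative d) (at 1 within {0..1})" and d: "d < 0"
    and pos: "\<And>v. v \<noteq> 0 \<Longrightarrow> v \<bullet> ((R ** hessian E x) *v v) > 0"
  shows "ihisd_locally_stable k E \<beta> \<gamma> \<sigma> \<epsilon> (x, R, 1)"
  unfolding ihisd_locally_stable_def
proof (intro allI impI, rule ccontr)
  fix z
  assume eig: "complex_eigenvalue_on (ihisd_tangent k (x, R, 1)) (ihisd_jacobian E \<beta> \<gamma> \<sigma> \<epsilon> (x, R, 1)) z"
  assume "\<not> Re z < 0"
  then have z: "Re z \<ge> 0" by simp
  define K where "K = R ** hessian E x"
  have symR: "transpose R = R"
    using R by (auto simp: reflections_def)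
  have symK: "transpose K = K"
    unfolding K_def by (simp add: matrix_transpose_mul hessian_symmetric[OF E] symR comm)
  have posK: "v \<noteq> 0 \<Longrightarrow> v \<bullet> (K *v v) > 0" for v
    unfolding K_def by (rule pos)
  obtain DH where DH: "(hessian E has_derivative DH) (at x)"
    using hessian_differentiable[OF E] unfolding differentiable_def by blast
  have DH0: "DH 0 = 0"
    by (rule linear_0[OF has_derivative_linear[OF DH]])
  note D = ihisd_field_has_derivative[OF E g0 DH de, of \<beta> \<gamma> \<sigma> R]
  have jac: "ihisd_jacobian E \<beta> \<gamma> \<sigma> \<epsilon> (x, R, 1) (u, S, a) =
      (- \<beta> *\<^sub>R (K *v u), \<gamma> *\<^sub>R (DH u - R ** DH u ** R - (S ** K + K ** S)), d * a)" for u S a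
    by (subst ihisd_jacobian_eq[OF _ D])
      (simp_all add: K_def mm.minus_left mv.minus_left matrix_vector_mul_assoc comm[symmetric] matrix_mul_assoc[symmetric] algebra_simps)
  obtain u S a v S' b where nz: "(u, S, a) \<noteq> 0 \<or> (v, S', b) \<noteq> 0"
    and eq: "ihisd_jacobian E \<beta> \<gamma> \<sigma> \<epsilon> (x, R, 1) (u, S, a) = Re z *\<^sub>R (u, S, a) - Im z *\<^sub>R (v, S', b)"
      "ihisd_jacobian E \<beta> \<gamma> \<sigma> \<epsilon> (x, R, 1) (v, S', b) = Im z *\<^sub>R (u, S, a) + Re z *\<^sub>R (v, S', b)"
    using eig unfolding complex_eigenvalue_on_def by (metis prod_cases3)
  have uv: "u = 0 \<and> v = 0"
  proof (rule negative_definite_eigenvalue[where a = "Re z" and b = "Im z" and L = "\<lambda>u. - \<beta> *\<^sub>R (K *v u)"])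
    show "w \<bullet> (- \<beta> *\<^sub>R (K *v w)) < 0" if "w \<noteq> 0" for w
      using posK[OF that] \<beta> by simp
  qed (use eq z in \<open>simp_all add: jac\<close>)
  have SS: "S = 0 \<and> S' = 0"
  proof (rule negative_definite_eigenvalue[where a = "Re z" and b = "Im z" and L = "\<lambda>S. \<gamma> *\<^sub>R (- (S ** K) - K ** S)"])
    show "W \<bullet> (\<gamma> *\<^sub>R (- (W ** K) - K ** W)) < 0" if "W \<noteq> 0" for W
      using mult_pos_pos[OF \<gamma> lyapunov_operator_positive[OF symK posK that]]
      by (simp add: inner_add_right inner_diff_right algebra_simps)
  qed (use eq z uv in \<open>simp_all add: jac DH0 mm.zero_left mm.zero_right\<close>)
  have "a = 0 \<and> b = 0"
  proof (rule negative_definite_eigenvalue[where a = "Re z" and b = "Im z" and L = "\<lambda>a. d * a"])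
    show "w \<bullet> (d * w) < 0" if "w \<noteq> 0" for w :: real
    proof -
      have "0 < w * w" using that not_real_square_gt_zero by blast
      from mult_neg_pos[OF d this] show ?thesis by (simp add: mult.left_commute)
    qed
  qed (use eq z in \<open>simp_all add: jac\<close>)
  with uv SS nz show False by (simp add: zero_prod_def)
qed

theorem theorem3p2:
  fixes E :: "real^'n \<Rightarrow> real" and k :: nat and \<beta> \<gamma> \<sigma> :: real and \<epsilon> :: "real \<Rightarrow> real"
    and x :: "real^'n" and R :: "real^'n^'n" and \<alpha> :: real
  assumes "assumption_A E"
    and "k \<le> CARD('n)"
    and "\<beta> > 0" and "\<gamma> > 0"
    and "\<sigma> \<in> {1, -1}"
    and "admissible_rate \<epsilon>"
    and "R \<in> reflections k" and "\<alpha> \<in> {0..1}"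
  shows "(ihisd_equilibrium k E \<beta> \<gamma> \<sigma> \<epsilon> (x, R, \<alpha>) \<longleftrightarrow>
            grad E x = 0 \<and> hessian E x ** R = R ** hessian E x \<and> \<alpha> \<in> {0, 1}) \<and>
         (ihisd_equilibrium k E \<beta> \<gamma> \<sigma> \<epsilon> (x, R, \<alpha>) \<and>
            invertible (hessian E x) \<and> distinct_eigenvalues (hessian E x) \<longrightarrow>
            (ihisd_locally_stable k E \<beta> \<gamma> \<sigma> \<epsilon> (x, R, \<alpha>) \<longleftrightarrow>
               k_saddle k E x \<and>
               is_reflection_about R (positive_eigensum (hessian E x)) \<and>
               \<alpha> = 1))"
proof (rule conjI)
  let ?H = "hessian E x"
  note equilibrium = ihisd_equilibrium_iff[OF assms(3-8), of E x]
  show "ihisd_equilibrium k E \<beta> \<gamma> \<sigma> \<epsilon> (x, R, \<alpha>) \<longleftrightarrow>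
      grad E x = 0 \<and> ?H ** R = R ** ?H \<and> \<alpha> \<in> {0, 1}"
    by (rule equilibrium)
  show "ihisd_equilibrium k E \<beta> \<gamma> \<sigma> \<epsilon> (x, R, \<alpha>) \<and> invertible ?H \<and> distinct_eigenvalues ?H \<longrightarrow>
    (ihisd_locally_stable k E \<beta> \<gamma> \<sigma> \<epsilon> (x, R, \<alpha>) \<longleftrightarrow>
      k_saddle k E x \<and> is_reflection_about R (positive_eigensum ?H) \<and> \<alpha> = 1)"
  proof (intro impI, elim conjE)
    assume eq: "ihisd_equilibrium k E \<beta> \<gamma> \<sigma> \<epsilon> (x, R, \<alpha>)"
      and invertible: "invertible ?H" and distinct: "distinct_eigenvalues ?H"
    have g0: "grad E x = 0" and comm: "?H ** R = R ** ?H" and \<alpha>: "\<alpha> = 0 \<or> \<alpha> = 1"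
      using eq equilibrium by auto
    have E: "smooth_on UNIV E"
      using assms(1) by (simp add: assumption_A_def morse_smale_def morse_def)
    have symH: "transpose ?H = ?H" by (rule hessian_symmetric[OF E])
    have symR: "transpose R = R" and inv: "R ** R = mat 1"
      and dim: "dim {v. (R + mat 1) *v v = 0} = k"
      using assms(7) by (auto simp: reflections_def)
    have nz: "0 \<notin> eigenvalues ?H"
    proof
      assume "0 \<in> eigenvalues ?H"
      then obtain v where "v \<noteq> 0" "?H *v v = 0" by (auto simp: eigenvalues_def)
      moreover obtain B where "B ** ?H = mat 1" using invertible by (auto simp: invertible_def)
      ultimately show False
        by (metis matrix_vector_mul_assoc matrix_vector_mul_lid matrix_vector_mult_0_right)
    qed
    obtain e where frame: "eigenframe ?H e"
      using eigenframe_exists[OF symH distinct] by blast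
    obtain r where r: "\<And>l. l \<in> eigenvalues ?H \<Longrightarrow> R *v e l = r l *\<^sub>R e l"
      and r1: "\<And>l. l \<in> eigenvalues ?H \<Longrightarrow> r l = 1 \<or> r l = -1"
      using commuting_involution_eigenframe[OF frame symH comm inv] by metis
    note reflection = reflection_about_positive_eigensum_iff[OF frame symH nz symR inv r r1]
    obtain d0 d1 where d: "(\<epsilon> has_real_derivative d0) (at 0 within {0..1})" "d0 > 0"
        "(\<epsilon> has_real_derivative d1) (at 1 within {0..1})" "d1 < 0"
      using admissible_rate_derivative[OF assms(6)] by metis
    show "ihisd_locally_stable k E \<beta> \<gamma> \<sigma> \<epsilon> (x, R, \<alpha>) \<longleftrightarrow>
      k_saddle k E x \<and> is_reflection_about R (positive_eigensum ?H) \<and> \<alpha> = 1"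
    proof
      assume stable: "ihisd_locally_stable k E \<beta> \<gamma> \<sigma> \<epsilon> (x, R, \<alpha>)"
      have \<alpha>1: "\<alpha> = 1"
        using \<alpha> stable not_stable_at_alpha_0[OF E g0 assms(7) d(1,2)] by blast
      have sgn: "\<forall>l\<in>eigenvalues ?H. r l * l > 0"
      proof
        fix l assume l: "l \<in> eigenvalues ?H"
        have "r l * l \<ge> 0"
          by (rule stable_imp_sign_product_nonneg[OF E g0 comm assms(3,7) d(3) stable[unfolded \<alpha>1]
                eigenframe_nonzero[OF frame l] eigenframe_eigenvector[OF frame l] r[OF l]])
        moreover have "r l * l \<noteq> 0"
          using nz l r1[OF l] by auto
        ultimately show "r l * l > 0" by linarith
      qed
      then have "neg_index ?H = k"
        using neg_index_eq_reflection_index[OF frame symH symR r r1] dim by simp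
      then show "k_saddle k E x \<and> is_reflection_about R (positive_eigensum ?H) \<and> \<alpha> = 1"
        using sgn reflection g0 \<alpha>1 by (simp add: k_saddle_def stationary_def)
    next
      assume *: "k_saddle k E x \<and> is_reflection_about R (positive_eigensum ?H) \<and> \<alpha> = 1"
      then have sgn: "\<forall>l\<in>eigenvalues ?H. r l * l > 0"
        using reflection by blast
      have symK: "transpose (R ** ?H) = R ** ?H"
        by (simp add: matrix_transpose_mul symH symR comm)
      have "ihisd_locally_stable k E \<beta> \<gamma> \<sigma> \<epsilon> (x, R, 1)"
        by (rule positive_definite_imp_stable[OF E g0 comm assms(3,4,7) d(3,4)
              commuting_frame_positive_definite[OF frame symK r sgn]])
      then show "ihisd_locally_stable k E \<beta> \<gamma> \<sigma> \<epsilon> (x, R, \<alpha>)"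
        using * by simp
    qed
  qed
qed

end
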